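(* Let $K$ be a number field, let $N \ge 1$ and $d \ge 2$ be integers, and let $\phi \colon \mathbb{P}^N_K \to \mathbb{P}^N_K$ be a morphism given in homogeneous coordinates by $N+1$ homogeneous polynomials of degree $d$ with coefficients in $K$ (with no common zero in $\mathbb{P}^N_{\bar K}$). Then there is a constant $B_\phi$, depending only on $\phi$ (and $K$), such that for every twist $\psi$ of $\phi$ over $K$, \[ \#\{P \in \mathbb{P}^N(K) : P \text{ is preperiodic for } \psi\} \le B_\phi . \]
   Context: For $f \in \mathrm{PGL}_{N+1}(\bar K)$ acting on $\mathbb{P}^N$ by linear fractional transformations, write $\phi^f = f\circ\phi\circ f^{-1}$. A twist of $\phi$ over $K$ is a morphism $\psi\colon\mathbb{P}^N_K\to\mathbb{P}^N_K$ defined over $K$ (given by homogeneous polynomials of degree $d$ with coefficients in $K$) such that $\psi = \phi^f$ for some $f \in \mathrm{PGL}_{N+1}(\bar K)$. A point $P$ is preperiodic for $\psi$ if $\psi^n(P)=\psi^m(P)$ for some integers $n>m\ge 0$, where $\psi^n$ is the $n$-th iterate. *)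

theory Defs
  imports
    "HOL-Analysis.Analysis"
    "HOL-Algebra.Algebraic_Closure_Type"
    "HOL-Library.Poly_Mapping"
begin

unbundle no fps_syntax

definition number_field :: "'k::field_char_0 itself \<Rightarrow> bool" where
  "number_field _ \<longleftrightarrow>
     (\<exists>B. finite_dimensional_vector_space (\<lambda>(q::rat) (x::'k). of_rat q * x) B)"

text \<open>\<open>('k, 'n) proj_space\<close> is the set of \<open>'k\<close>-rational points of projective space of dimension
  \<open>CARD('n) - 1\<close>: non-zero vectors modulo non-zero scalars. The relation is partial
  (the zero vector is related to nothing); \<open>proj_pt 0\<close> is a dummy value.\<close>

definition proj_rel :: "'k::field ^ 'n \<Rightarrow> 'k ^ 'n \<Rightarrow> bool" where
  "proj_rel x y \<longleftrightarrow> x \<noteq> 0 \<and> y \<noteq> 0 \<and> (\<exists>c. c \<noteq> 0 \<and> y = c *s x)"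

lemma part_equivp_proj_rel: "part_equivp (proj_rel :: 'k::field ^ 'n \<Rightarrow> _)"
proof (rule part_equivpI)
  have "((\<chi> i. 1) :: 'k ^ 'n) \<noteq> 0"
    by (simp add: vec_eq_iff)
  then show "\<exists>x :: 'k ^ 'n. proj_rel x x"
    unfolding proj_rel_def by (metis one_neq_zero vector_smult_lid)
  show "symp (proj_rel :: 'k ^ 'n \<Rightarrow> _)"
  proof (rule sympI)
    fix x y :: "'k ^ 'n"
    assume "proj_rel x y"
    then obtain c where c: "x \<noteq> 0" "y \<noteq> 0" "c \<noteq> 0" "y = c *s x"
      by (auto simp: proj_rel_def)
    then have "x = inverse c *s y"
      by (simp add: vector_smult_assoc)
    with c show "proj_rel y x"
      unfolding proj_rel_def by (metis nonzero_imp_inverse_nonzero)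
  qed
  show "transp (proj_rel :: 'k ^ 'n \<Rightarrow> _)"
    unfolding proj_rel_def by (rule transpI) (metis mult_eq_0_iff vector_smult_assoc)
qed

quotient_type (overloaded) ('k, 'n) proj_space = "'k::field ^ 'n::finite" / partial: proj_rel
  by (rule part_equivp_proj_rel)

lift_definition proj_pt :: "'k::field ^ 'n::finite \<Rightarrow> ('k, 'n) proj_space"
  is "\<lambda>x. if x = 0 then (\<chi> i. 1) else x"
  by (auto simp: proj_rel_def vec_eq_iff intro: exI[of _ 1])

lemma proj_pt_eq_iff:
  assumes "x \<noteq> 0" "y \<noteq> 0"
  shows "proj_pt x = proj_pt y \<longleftrightarrow> (\<exists>c. c \<noteq> 0 \<and> y = c *s x)"
  using assms by transfer (auto simp: proj_rel_def)

lemma proj_pt_surj: "\<exists>x. x \<noteq> 0 \<and> P = proj_pt x"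
  by transfer (auto simp: proj_rel_def)

lift_definition proj_to_ac :: "('k::field, 'n::finite) proj_space \<Rightarrow> ('k alg_closure, 'n) proj_space"
  is "\<lambda>x. \<chi> i. to_ac (x $ i)"
  by (auto simp: proj_rel_def vec_eq_iff) (metis to_ac_eq_0_iff)

text \<open>The projective linear group, as a group of transformations of projective space.\<close>

definition PGL :: "(('k::field, 'n::finite) proj_space \<Rightarrow> ('k, 'n) proj_space) set" where
  "PGL = {f. \<exists>A :: 'k ^ 'n ^ 'n. invertible A \<and>
              (\<forall>x. x \<noteq> 0 \<longrightarrow> f (proj_pt x) = proj_pt (A *v x))}"

lemma bij_PGL:
  assumes "f \<in> PGL"
  shows "bij f"
proof -
  obtain A where "invertible A" and f: "\<And>x. x \<noteq> 0 \<Longrightarrow> f (proj_pt x) = proj_pt (A *v x)"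
    using assms by (auto simp: PGL_def)
  then obtain A' where A': "A ** A' = mat 1" "A' ** A = mat 1"
    by (auto simp: invertible_def)
  have inverse: "A *v (A' *v x) = x" "A' *v (A *v x) = x" for x
    using A' by (simp_all add: matrix_vector_mul_assoc)
  have nz: "A *v x \<noteq> 0" "A' *v x \<noteq> 0" if "x \<noteq> 0" for x
    using inverse[of x] that by (metis matrix_vector_mult_0_right)+
  show ?thesis
  proof (rule bijI)
    show "inj f"
    proof (rule injI)
      fix P Q
      assume eq: "f P = f Q"
      obtain x y where x: "x \<noteq> 0" "P = proj_pt x" and y: "y \<noteq> 0" "Q = proj_pt y"
        using proj_pt_surj by metis
      with eq f nz obtain c where c: "c \<noteq> 0" "A *v y = c *s (A *v x)"
        by (auto simp: proj_pt_eq_iff)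
      then have "A' *v (A *v y) = A' *v (c *s (A *v x))"
        by simp
      then have "y = c *s x"
        by (simp add: inverse vector_scalar_commute)
      with c x y show "P = Q"
        by (auto simp: proj_pt_eq_iff)
    qed
    show "surj f"
      unfolding surj_def by (metis proj_pt_surj f nz(2) inverse(1))
  qed
qed

text \<open>Polynomials in variables indexed by \<open>'n\<close>: finitely supported maps from exponent vectors to
  coefficients.\<close>

type_synonym ('k, 'n) mpoly = "('n \<Rightarrow>\<^sub>0 nat) \<Rightarrow>\<^sub>0 'k"

definition mpoly_eval :: "('k::comm_ring_1, 'n::finite) mpoly \<Rightarrow> 'k ^ 'n \<Rightarrow> 'k" where
  "mpoly_eval p x =
     (\<Sum>m\<in>Poly_Mapping.keys p. Poly_Mapping.lookup p m * (\<Prod>i\<in>UNIV. (x $ i) ^ Poly_Mapping.lookup m i))"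

definition homogeneous :: "nat \<Rightarrow> ('k::zero, 'n::finite) mpoly \<Rightarrow> bool" where
  "homogeneous d p \<longleftrightarrow> (\<forall>m\<in>Poly_Mapping.keys p. (\<Sum>i\<in>UNIV. Poly_Mapping.lookup m i) = d)"

definition eval_ac ::
    "('n \<Rightarrow> ('k::field, 'n::finite) mpoly) \<Rightarrow> 'k alg_closure ^ 'n \<Rightarrow> 'k alg_closure ^ 'n" where
  "eval_ac F x = (\<chi> i. mpoly_eval (Poly_Mapping.map to_ac (F i)) x)"

text \<open>A morphism defined over \<open>'k\<close> and given by forms of degree \<open>d\<close> is identified with the map it
  induces on geometric points; this determines the morphism.\<close>

definition proj_morphism ::
    "nat \<Rightarrow> (('k::field alg_closure, 'n::finite) proj_space \<Rightarrow> ('k alg_closure, 'n) proj_space) \<Rightarrow> bool"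
  where
  "proj_morphism d \<phi> \<longleftrightarrow>
     (\<exists>F :: 'n \<Rightarrow> ('k, 'n) mpoly.
        (\<forall>i. homogeneous d (F i)) \<and>
        (\<forall>x. x \<noteq> 0 \<longrightarrow> eval_ac F x \<noteq> 0) \<and>
        (\<forall>x. x \<noteq> 0 \<longrightarrow> \<phi> (proj_pt x) = proj_pt (eval_ac F x)))"

definition proj_conj ::
    "(('k::field, 'n::finite) proj_space \<Rightarrow> ('k, 'n) proj_space) \<Rightarrow>
     (('k, 'n) proj_space \<Rightarrow> ('k, 'n) proj_space) \<Rightarrow> (('k, 'n) proj_space \<Rightarrow> ('k, 'n) proj_space)"
  where "proj_conj \<phi> f = f \<circ> \<phi> \<circ> inv_into UNIV f"

definition twist ::
    "nat \<Rightarrow> (('k::field alg_closure, 'n::finite) proj_space \<Rightarrow> ('k alg_closure, 'n) proj_space) \<Rightarrow>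
     (('k alg_closure, 'n) proj_space \<Rightarrow> ('k alg_closure, 'n) proj_space) \<Rightarrow> bool"
  where
  "twist d \<phi> \<psi> \<longleftrightarrow> proj_morphism d \<psi> \<and> (\<exists>f\<in>PGL. \<psi> = proj_conj \<phi> f)"

definition preperiodic :: "('a \<Rightarrow> 'a) \<Rightarrow> 'a \<Rightarrow> bool" where
  "preperiodic \<psi> P \<longleftrightarrow> (\<exists>n m :: nat. n > m \<and> (\<psi> ^^ n) P = (\<psi> ^^ m) P)"

end

theory Submission
  imports Defs
begin

text \<open>
  Let \<open>\<Omega>\<close> be the algebraic closure. Call \<open>\<alpha> \<in> \<Omega>\<close> \<open>r\<close>-bounded if the powers of \<open>\<alpha>\<close> are integer combinations of
  finitely many fixed elements with coefficients \<open>O(r^k)\<close>; this says that \<open>\<alpha>\<close> is an algebraic integer whose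
  conjugates have absolute value at most \<open>r\<close>. Bounds add under sums and multiply under products, and an
  \<open>r\<close>-bounded element divisible by an integer \<open>m > r\<close> vanishes. Pigeonhole then gives a Northcott property: only
  finitely many elements of the number field are quotients of two \<open>r\<close>-bounded elements, even though the
  numerator and denominator may have arbitrarily large degree.

  Write \<open>F\<close> for the forms defining \<open>\<phi>\<close>. A preperiodic point has a lift \<open>x\<close> with \<open>F^n x = F^m x\<close> exactly,
  since scalars can be absorbed in \<open>\<Omega>\<close>. By the Nullstellensatz powers of the coordinates lie in the ideal
  generated by \<open>F\<close>; substituted along the orbit, this expresses powers of the coordinates by terms of lower
  degree, so a fixed multiple of \<open>x\<close> has \<open>r\<close>-bounded coordinates, with \<open>r\<close> depending only on \<open>\<phi>\<close>.

  If \<open>f\<close> conjugates \<open>\<phi>\<close> to a twist \<open>\<psi>\<close>, then \<open>f\<close> carries bounded lifts of preperiodic points of \<open>\<phi>\<close> to the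
  rational preperiodic points of \<open>\<psi>\<close>. Cross-ratios are invariant under \<open>f\<close>, hence rational, and they are quotients of
  determinants of bounded lifts; so they take finitely many values, independently of \<open>\<psi>\<close>, and they determine
  the points. In particular no information on the automorphism group of \<open>\<phi>\<close> or on the field of definition
  of \<open>f\<close> is needed.
\<close>

section \<open>Bounded algebraic integers\<close>

text \<open>Coefficients are measured by the sum of their absolute values, a norm that is
  subadditive for sums and submultiplicative for products of combinations.\<close>

definition zspan :: "'a::field_char_0 set \<Rightarrow> real \<Rightarrow> 'a set" where
  "zspan V r = {x. \<exists>a::'a \<Rightarrow> int. x = (\<Sum>v\<in>V. of_int (a v) * v) \<and> (\<Sum>v\<in>V. \<bar>real_of_int (a v)\<bar>) \<le> r}"

text \<open>\<open>V\<close> and \<open>C\<close> may depend on \<open>x\<close> in any way; only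
  the growth rate \<open>r\<close> is recorded, which is why rates add and multiply without extra
  constants.\<close>

definition bounded_int :: "real \<Rightarrow> 'a::field_char_0 \<Rightarrow> bool" where
  "bounded_int r x \<longleftrightarrow> r \<ge> 0 \<and> (\<exists>V C. finite V \<and> C \<ge> 0 \<and> (\<forall>k. x ^ k \<in> zspan V (C * r ^ k)))"

lemma zspan_mono: "x \<in> zspan V r \<Longrightarrow> r \<le> s \<Longrightarrow> x \<in> zspan V s"
  unfolding zspan_def by fastforce

lemma zspan_zero: "0 \<le> r \<Longrightarrow> 0 \<in> zspan V r"
  unfolding zspan_def by (auto intro!: exI[of _ "\<lambda>_. 0"])

lemma zspan_base: "finite V \<Longrightarrow> v \<in> V \<Longrightarrow> v \<in> zspan V 1"
  unfolding zspan_def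
  by (auto intro!: exI[of _ "\<lambda>u. if u = v then 1 else 0"] simp: if_distrib[of real_of_int] if_distrib[of abs] if_distrib[of of_int]
      if_distrib[of "\<lambda>x. x * _"] cong: if_cong)

lemma zspan_add:
  assumes "x \<in> zspan V r" "y \<in> zspan V s"
  shows "x + y \<in> zspan V (r + s)"
proof -
  obtain a b where *: "x = (\<Sum>v\<in>V. of_int (a v) * v)" "(\<Sum>v\<in>V. \<bar>real_of_int (a v)\<bar>) \<le> r"
    "y = (\<Sum>v\<in>V. of_int (b v) * v)" "(\<Sum>v\<in>V. \<bar>real_of_int (b v)\<bar>) \<le> s"
    using assms unfolding zspan_def by blast
  have "(\<Sum>v\<in>V. \<bar>real_of_int (a v + b v)\<bar>) \<le> (\<Sum>v\<in>V. \<bar>real_of_int (a v)\<bar> + \<bar>real_of_int (b v)\<bar>)"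
    by (intro sum_mono) auto
  also have "\<dots> \<le> r + s" using * by (simp add: sum.distrib)
  finally show ?thesis
    unfolding zspan_def using *
    by (auto intro!: exI[of _ "\<lambda>v. a v + b v"] simp: sum.distrib algebra_simps)
qed

lemma zspan_scale:
  assumes "x \<in> zspan V r"
  shows "of_int n * x \<in> zspan V (\<bar>real_of_int n\<bar> * r)"
proof -
  obtain a where *: "x = (\<Sum>v\<in>V. of_int (a v) * v)" "(\<Sum>v\<in>V. \<bar>real_of_int (a v)\<bar>) \<le> r"
    using assms unfolding zspan_def by blast
  have "(\<Sum>v\<in>V. \<bar>real_of_int (n * a v)\<bar>) = \<bar>real_of_int n\<bar> * (\<Sum>v\<in>V. \<bar>real_of_int (a v)\<bar>)"
    by (simp add: sum_distrib_left abs_mult)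
  also have "\<dots> \<le> \<bar>real_of_int n\<bar> * r" using * by (intro mult_left_mono) auto
  finally show ?thesis
    unfolding zspan_def using *
    by (auto intro!: exI[of _ "\<lambda>v. n * a v"] simp: sum_distrib_left algebra_simps)
qed

lemma zspan_sum:
  assumes "finite I" "\<And>i. i \<in> I \<Longrightarrow> x i \<in> zspan V (r i)"
  shows "(\<Sum>i\<in>I. x i) \<in> zspan V (\<Sum>i\<in>I. r i)"
  using assms by (induction I rule: finite_induct) (auto intro: zspan_zero zspan_add)

text \<open>Distinct pairs may have equal products, so coefficients over the product set are not
  read off directly: each single product has norm at most 1, and \<open>zspan_sum\<close> merges
  repetitions.\<close>

lemma zspan_mult:
  assumes "finite V" "finite W" "x \<in> zspan V r" "y \<in> zspan W s" "0 \<le> r"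
  shows "x * y \<in> zspan ((\<lambda>(v, w). v * w) ` (V \<times> W)) (r * s)"
proof -
  let ?U = "(\<lambda>(v, w). v * w) ` (V \<times> W)"
  obtain a b where *: "x = (\<Sum>v\<in>V. of_int (a v) * v)" "(\<Sum>v\<in>V. \<bar>real_of_int (a v)\<bar>) \<le> r"
    "y = (\<Sum>v\<in>W. of_int (b v) * v)" "(\<Sum>v\<in>W. \<bar>real_of_int (b v)\<bar>) \<le> s"
    using assms unfolding zspan_def by blast
  have "x * y = (\<Sum>v\<in>V. \<Sum>w\<in>W. of_int (a v * b w) * (v * w))"
    unfolding * by (simp add: sum_product algebra_simps)
  also have "\<dots> \<in> zspan ?U (\<Sum>v\<in>V. \<Sum>w\<in>W. \<bar>real_of_int (a v * b w)\<bar> * 1)"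
    using assms by (intro zspan_sum zspan_scale zspan_base) auto
  also have "(\<Sum>v\<in>V. \<Sum>w\<in>W. \<bar>real_of_int (a v * b w)\<bar> * 1) =
      (\<Sum>v\<in>V. \<bar>real_of_int (a v)\<bar>) * (\<Sum>w\<in>W. \<bar>real_of_int (b w)\<bar>)"
    by (simp add: sum_product abs_mult)
  finally show ?thesis
    by (rule zspan_mono) (use * assms in \<open>auto intro!: mult_mono sum_nonneg\<close>)
qed

lemma bounded_intE:
  assumes "bounded_int r x"
  obtains V C where "finite V" "C \<ge> 0" "\<And>k. x ^ k \<in> zspan V (C * r ^ k)" "r \<ge> 0"
  using assms unfolding bounded_int_def by blast

lemma bounded_intI:
  assumes "finite V" "C \<ge> 0" "\<And>k. x ^ k \<in> zspan V (C * r ^ k)" "r \<ge> 0"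
  shows "bounded_int r x"
  using assms unfolding bounded_int_def by blast

lemma bounded_int_nonneg: "bounded_int r x \<Longrightarrow> 0 \<le> r"
  unfolding bounded_int_def by blast

lemma bounded_int_mono:
  assumes "bounded_int r x" "r \<le> s"
  shows "bounded_int s x"
proof (rule bounded_intE[OF assms(1)])
  fix V C assume *: "finite V" "0 \<le> C" "\<And>k. x ^ k \<in> zspan V (C * r ^ k)" "0 \<le> r"
  show ?thesis
    by (rule bounded_intI[OF *(1,2)], rule zspan_mono[OF *(3)])
      (use * assms in \<open>auto intro!: mult_left_mono power_mono\<close>)
qed

lemma bounded_int_of_int: "bounded_int \<bar>real_of_int n\<bar> (of_int n)"
proof (rule bounded_intI[of "{1}" 1])
  fix k
  have "of_int (n ^ k) * 1 \<in> zspan {1} (\<bar>real_of_int (n ^ k)\<bar> * 1)"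
    by (intro zspan_scale zspan_base) auto
  then show "of_int n ^ k \<in> zspan {1} (1 * \<bar>real_of_int n\<bar> ^ k)"
    by (simp add: power_abs)
qed auto

lemma bounded_int_mult:
  assumes "bounded_int r x" "bounded_int s y"
  shows "bounded_int (r * s) (x * y)"
proof (rule bounded_intE[OF assms(1)], rule bounded_intE[OF assms(2)])
  fix V C W D
  assume *: "finite V" "0 \<le> C" "\<And>k. x ^ k \<in> zspan V (C * r ^ k)" "0 \<le> r"
    "finite W" "0 \<le> D" "\<And>k. y ^ k \<in> zspan W (D * s ^ k)" "0 \<le> s"
  show ?thesis
  proof (rule bounded_intI[of "(\<lambda>(v, w). v * w) ` (V \<times> W)" "C * D"])
    fix k
    have "x ^ k * y ^ k \<in> zspan ((\<lambda>(v, w). v * w) ` (V \<times> W)) ((C * r ^ k) * (D * s ^ k))"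
      using * by (intro zspan_mult) auto
    then show "(x * y) ^ k \<in> zspan ((\<lambda>(v, w). v * w) ` (V \<times> W)) (C * D * (r * s) ^ k)"
      by (simp add: power_mult_distrib algebra_simps)
  qed (use * in auto)
qed

text \<open>In the binomial expansion the bounds of the terms add up to exactly
  \<open>C * D * (r + s) ^ k\<close>, so no factor growing with \<open>k\<close> is lost.\<close>

lemma bounded_int_add:
  assumes "bounded_int r x" "bounded_int s y"
  shows "bounded_int (r + s) (x + y)"
proof (rule bounded_intE[OF assms(1)], rule bounded_intE[OF assms(2)])
  fix V C W D
  assume *: "finite V" "0 \<le> C" "\<And>k. x ^ k \<in> zspan V (C * r ^ k)" "0 \<le> r"
    "finite W" "0 \<le> D" "\<And>k. y ^ k \<in> zspan W (D * s ^ k)" "0 \<le> s"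
  let ?U = "(\<lambda>(v, w). v * w) ` (V \<times> W)"
  show ?thesis
  proof (rule bounded_intI[of ?U "C * D"])
    fix k
    have "(x + y) ^ k = (\<Sum>i\<le>k. of_int (int (k choose i)) * (x ^ i * y ^ (k - i)))"
      by (simp add: binomial_ring mult.assoc)
    also have "\<dots> \<in> zspan ?U (\<Sum>i\<le>k. \<bar>real_of_int (int (k choose i))\<bar> * ((C * r ^ i) * (D * s ^ (k - i))))"
      using * by (intro zspan_sum zspan_scale zspan_mult) auto
    also have "(\<Sum>i\<le>k. \<bar>real_of_int (int (k choose i))\<bar> * ((C * r ^ i) * (D * s ^ (k - i)))) = C * D * (r + s) ^ k"
      by (simp add: binomial_ring sum_distrib_left algebra_simps)
    finally show "(x + y) ^ k \<in> zspan ?U (C * D * (r + s) ^ k)" .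
  qed (use * in auto)
qed

lemma bounded_int_scale: "bounded_int r x \<Longrightarrow> bounded_int (\<bar>real_of_int n\<bar> * r) (of_int n * x)"
  by (intro bounded_int_mult bounded_int_of_int)

lemma bounded_int_diff:
  assumes "bounded_int r x" "bounded_int s y"
  shows "bounded_int (r + s) (x - y)"
  using bounded_int_add[OF assms(1) bounded_int_scale[OF assms(2), of "-1"]] by simp

lemma bounded_int_0: "r \<ge> 0 \<Longrightarrow> bounded_int r 0"
  by (rule bounded_int_mono[OF bounded_int_of_int[of 0, simplified]])

lemma bounded_int_1: "bounded_int 1 1"
  using bounded_int_of_int[of 1] by simp

lemma bounded_int_sum:
  assumes "finite I" "\<And>i. i \<in> I \<Longrightarrow> bounded_int (r i) (x i)"
  shows "bounded_int (\<Sum>i\<in>I. r i) (\<Sum>i\<in>I. x i)"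
  using assms by (induction I rule: finite_induct) (auto intro: bounded_int_0 bounded_int_add)

lemma bounded_int_prod:
  assumes "finite I" "\<And>i. i \<in> I \<Longrightarrow> bounded_int (r i) (x i)"
  shows "bounded_int (\<Prod>i\<in>I. r i) (\<Prod>i\<in>I. x i)"
  using assms by (induction I rule: finite_induct) (auto intro: bounded_int_1 bounded_int_mult)

text \<open>One pair \<open>V\<close>, \<open>C\<close> serves all exponent vectors at once.
  Rewriting by relations accumulates arbitrarily high powers of the coefficients, so this uniformity
  is essential there.\<close>

lemma zspan_monomials:
  assumes "finite T" "\<And>t. t \<in> T \<Longrightarrow> bounded_int r (c t)"
  shows "\<exists>V C. finite V \<and> C \<ge> 0 \<and> (\<forall>k. (\<Prod>t\<in>T. c t ^ k t) \<in> zspan V (C * r ^ (\<Sum>t\<in>T. k t)))"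
  using assms
proof (induction T rule: finite_induct)
  case empty
  then show ?case by (auto intro!: exI[of _ "{1}"] exI[of _ 1] zspan_base)
next
  case (insert u T)
  obtain V C where V: "finite V" "C \<ge> 0" "\<And>k. (\<Prod>t\<in>T. c t ^ k t) \<in> zspan V (C * r ^ (\<Sum>t\<in>T. k t))"
    using insert by auto
  obtain W D where W: "finite W" "D \<ge> 0" "\<And>k. c u ^ k \<in> zspan W (D * r ^ k)" "r \<ge> 0"
    using insert.prems[of u] by (auto elim: bounded_intE)
  show ?case
  proof (intro exI[of _ "(\<lambda>(v, w). v * w) ` (W \<times> V)"] exI[of _ "D * C"] conjI allI)
    fix k
    have "c u ^ k u * (\<Prod>t\<in>T. c t ^ k t) \<in> zspan ((\<lambda>(v, w). v * w) ` (W \<times> V)) ((D * r ^ k u) * (C * r ^ (\<Sum>t\<in>T. k t)))"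
      using V W by (intro zspan_mult) auto
    then show "(\<Prod>t\<in>insert u T. c t ^ k t) \<in> zspan ((\<lambda>(v, w). v * w) ` (W \<times> V)) (D * C * r ^ (\<Sum>t\<in>insert u T. k t))"
      using insert.hyps by (simp add: power_add algebra_simps)
  qed (use V W in auto)
qed

text \<open>The relations rewrite every monomial into reduced ones (exponents below \<open>e\<close>) of smaller degree; giving
  each variable weight \<open>r\<close>, no rewriting step increases the weighted norm.\<close>

lemma bounded_int_of_relations:
  fixes z :: "'j \<Rightarrow> 'a::field_char_0" and c :: "'j \<Rightarrow> 't \<Rightarrow> 'a"
  assumes J: "finite J" and T: "finite T"
    and c: "\<And>j t. j \<in> J \<Longrightarrow> t \<in> T \<Longrightarrow> bounded_int g (c j t)"
    and rel: "\<And>j. j \<in> J \<Longrightarrow> z j ^ e j = (\<Sum>t\<in>T. c j t * (\<Prod>i\<in>J. z i ^ E j t i))"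
    and deg: "\<And>j t. j \<in> J \<Longrightarrow> t \<in> T \<Longrightarrow> (\<Sum>i\<in>J. E j t i) < e j"
    and r: "r \<ge> 1" "r \<ge> of_nat (card T) * g"
    and j: "j \<in> J"
  shows "bounded_int r (z j)"
proof -
  define c' where "c' = (\<lambda>(j, t). c j t)"
  have g: "r ^ n \<ge> 0" for n using r by auto
  obtain V C where V: "finite V" "C \<ge> 0"
    "\<And>k. (\<Prod>t\<in>J \<times> T. c' t ^ k t) \<in> zspan V (C * g ^ (\<Sum>t\<in>J \<times> T. k t))"
    using zspan_monomials[of "J \<times> T" g c'] c J T by (auto simp: c'_def)
  have g0: "g \<ge> 0" if "t \<in> T" for t using c[OF j that] bounded_int_nonneg by blast
  define R where "R = (\<lambda>f. \<Prod>i\<in>J. z i ^ f i) ` (\<Pi>\<^sub>E i\<in>J. {..<e i})"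
  have R: "finite R" unfolding R_def using J by (intro finite_imageI finite_PiE) auto
  let ?U = "(\<lambda>(v, w). v * w) ` (V \<times> R)"
  \<comment> \<open>The coefficients collected so far are kept as a monomial with exponents
    \<open>k\<close>, so that every stage of the rewriting is expressed in the same finite set
    \<open>?U\<close>.\<close>
  have main: "(\<Prod>t\<in>J \<times> T. c' t ^ k t) * (\<Prod>i\<in>J. z i ^ f i)
      \<in> zspan ?U (C * g ^ (\<Sum>t\<in>J \<times> T. k t) * r ^ (\<Sum>i\<in>J. f i))" (is "?P k f") for k f
  proof (induction "\<Sum>i\<in>J. f i" arbitrary: k f rule: less_induct)
    case less
    \<comment> \<open>\<open>g\<close> is known to be nonnegative only through some bounded
      coefficient; if \<open>T\<close> is empty there is none, but then the exponent is 0.\<close>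
    have gk: "0 \<le> g ^ (\<Sum>t\<in>J \<times> T. k t)"
    proof (cases "T = {}")
      case False then show ?thesis using g0 by auto
    qed simp
    show ?case
    proof (cases "\<forall>i\<in>J. f i < e i")
      case True
      have "(\<Prod>i\<in>J. z i ^ f i) \<in> R"
        unfolding R_def by (rule image_eqI[of _ _ "restrict f J"]) (use True in \<open>auto intro: prod.cong\<close>)
      then have "(\<Prod>t\<in>J \<times> T. c' t ^ k t) * (\<Prod>i\<in>J. z i ^ f i) \<in> zspan ?U ((C * g ^ (\<Sum>t\<in>J \<times> T. k t)) * 1)"
        using V R gk by (intro zspan_mult zspan_base) auto
      then show ?thesis
        by (rule zspan_mono, intro mult_left_mono) (use V gk r in \<open>auto intro!: one_le_power\<close>)
    next
      case False
      then obtain i where i: "i \<in> J" "e i \<le> f i" by auto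
      \<comment> \<open>One factor \<open>z i ^ e i\<close> is replaced by the term \<open>t\<close>
        of its relation: \<open>f'\<close> is the new monomial, and \<open>k'\<close> records one
        more use of \<open>c i t\<close>.\<close>
      define f' where "f' = (\<lambda>t l. (if l = i then f l - e i else f l) + E i t l)"
      define k' where "k' = (\<lambda>t. k((i, t) := Suc (k (i, t))))"
      have split: "(\<Prod>l\<in>J. z l ^ f l) = z i ^ e i * (\<Prod>l\<in>J. z l ^ (if l = i then f l - e i else f l))"
      proof -
        have "(\<Prod>l\<in>J. z l ^ f l) = z i ^ f i * (\<Prod>l\<in>J - {i}. z l ^ f l)"
          using J i by (simp add: prod.remove)
        also have "\<dots> = z i ^ e i * (z i ^ (f i - e i) * (\<Prod>l\<in>J - {i}. z l ^ f l))"
          using i by (simp add: power_add[symmetric] mult.assoc[symmetric])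
        also have "z i ^ (f i - e i) * (\<Prod>l\<in>J - {i}. z l ^ f l) = (\<Prod>l\<in>J. z l ^ (if l = i then f l - e i else f l))"
          using J i by (simp add: prod.remove[of J i])
        finally show ?thesis .
      qed
      have fsum: "(\<Sum>l\<in>J. f l) = e i + (\<Sum>l\<in>J. (if l = i then f l - e i else f l))"
        using J i by (simp add: sum.remove[of J i])
      have f'sum: "(\<Sum>l\<in>J. f' t l) < (\<Sum>l\<in>J. f l)" if "t \<in> T" for t
        unfolding f'_def fsum sum.distrib using deg[OF i(1) that] by simp
      have k'sum: "(\<Sum>l\<in>J \<times> T. k' t l) = Suc (\<Sum>l\<in>J \<times> T. k l)" if "t \<in> T" for t
        using J T i that by (simp add: sum.remove[of "J \<times> T" "(i, t)"] k'_def)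
      have k'prod: "(\<Prod>l\<in>J \<times> T. c' l ^ k' t l) = (\<Prod>l\<in>J \<times> T. c' l ^ k l) * c i t" if "t \<in> T" for t
        using J T i that by (simp add: prod.remove[of "J \<times> T" "(i, t)"] k'_def) (simp add: c'_def)
      have "(\<Prod>t\<in>J \<times> T. c' t ^ k t) * (\<Prod>i\<in>J. z i ^ f i) =
          (\<Sum>t\<in>T. (\<Prod>l\<in>J \<times> T. c' l ^ k' t l) * (\<Prod>l\<in>J. z l ^ f' t l))"
        unfolding split rel[OF i(1)]
        by (simp add: sum_distrib_left sum_distrib_right k'prod f'_def power_add prod.distrib algebra_simps)
      also have "\<dots> \<in> zspan ?U (\<Sum>t\<in>T. C * g ^ (\<Sum>l\<in>J \<times> T. k' t l) * r ^ (\<Sum>l\<in>J. f' t l))"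
        using T f'sum by (intro zspan_sum less) auto
      finally show ?thesis
      proof (rule zspan_mono)
        \<comment> \<open>Lowering the degree by one must not be truncated at 0. With no terms the
          relation reads \<open>z i ^ e i = 0\<close>, which excludes
          \<open>e i = 0\<close>.\<close>
        have pos: "(\<Sum>l\<in>J. f l) > 0"
        proof (cases "T = {}")
          case True
          then have "e i \<noteq> 0" using rel[OF i(1)] by (auto intro: ccontr)
          then show ?thesis using fsum by simp
        next
          case False
          then show ?thesis using f'sum by fastforce
        qed
        have "(\<Sum>t\<in>T. C * g ^ (\<Sum>l\<in>J \<times> T. k' t l) * r ^ (\<Sum>l\<in>J. f' t l))
            \<le> (\<Sum>t\<in>T. C * g ^ Suc (\<Sum>l\<in>J \<times> T. k l) * r ^ ((\<Sum>l\<in>J. f l) - 1))"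
        proof (intro sum_mono mult_mono)
          fix t assume t: "t \<in> T"
          have "sum (f' t) J \<le> sum f J - 1" using f'sum[OF t] by linarith
          then show "r ^ sum (f' t) J \<le> r ^ (sum f J - 1)" using r by (intro power_increasing) auto
        qed (use V g0 r k'sum in \<open>auto intro!: mult_nonneg_nonneg\<close>)
        also have "\<dots> = C * g ^ (\<Sum>l\<in>J \<times> T. k l) * (r ^ ((\<Sum>l\<in>J. f l) - 1) * (of_nat (card T) * g))"
          by simp
        \<comment> \<open>The degree dropped by at least one, and the freed factor \<open>r\<close>
          pays for \<open>card T\<close> terms with coefficients of rate \<open>g\<close>.\<close>
        also have "\<dots> \<le> C * g ^ (\<Sum>l\<in>J \<times> T. k l) * (r ^ ((\<Sum>l\<in>J. f l) - 1) * r)"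
          using V r gk g by (intro mult_left_mono) auto
        also have "r ^ ((\<Sum>l\<in>J. f l) - 1) * r = r ^ (\<Sum>l\<in>J. f l)"
          using pos by (metis power_minus_mult)
        finally show "(\<Sum>t\<in>T. C * g ^ (\<Sum>l\<in>J \<times> T. k' t l) * r ^ (\<Sum>l\<in>J. f' t l))
            \<le> C * g ^ (\<Sum>l\<in>J \<times> T. k l) * r ^ (\<Sum>l\<in>J. f l)" .
      qed
    qed
  qed
  show ?thesis
  proof (rule bounded_intI[of ?U C])
    fix k
    show "z j ^ k \<in> zspan ?U (C * r ^ k)"
      using main[of "\<lambda>_. 0" "\<lambda>i. if i = j then k else 0"] J j
      by (simp add: if_distrib[of "\<lambda>x. _ ^ x"] cong: if_cong)
  qed (use V R r in auto)
qed

section \<open>Northcott finiteness\<close>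

lemma common_denominator:
  assumes "finite A"
  shows "\<exists>D::int. D > 0 \<and> (\<forall>q\<in>A. of_int D * (q::rat) \<in> \<int>)"
  using assms
proof (induction A rule: finite_induct)
  case empty
  then show ?case by (auto intro: exI[of _ 1])
next
  case (insert q A)
  then obtain D where D: "D > 0" "\<And>q. q \<in> A \<Longrightarrow> of_int D * (q::rat) \<in> \<int>" by auto
  obtain a b where ab: "q = of_int a / of_int b" "b > 0"
    by (metis quotient_of_div quotient_of_denom_pos surj_pair)
  have "of_int (D * b) * q \<in> \<int>" using ab by simp
  moreover have "of_int (D * b) * p \<in> \<int>" if "p \<in> A" for p
    using Ints_mult[OF Ints_of_int[of b] D(2)[OF that]] by (simp add: algebra_simps)
  ultimately show ?case using D ab by (intro exI[of _ "D * b"]) auto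
qed

lemma vector_space_of_rat: "vector_space (\<lambda>q x. of_rat q * (x :: 'a::field_char_0))"
  by unfold_locales (simp_all add: algebra_simps of_rat_add of_rat_mult)

lemma exists_power_dominated:
  fixes C x y :: real
  assumes "0 \<le> x" "x < y"
  shows "\<exists>k. C * x ^ k < y ^ k"
proof -
  have "(\<lambda>k. C * (x / y) ^ k) \<longlonglongrightarrow> C * 0"
    using assms by (intro tendsto_mult tendsto_const LIMSEQ_power_zero) auto
  then have "\<forall>\<^sub>F k in sequentially. C * (x / y) ^ k < 1"
    by (auto dest: order_tendstoD(2)[where a = 1])
  then obtain k where "C * (x / y) ^ k < 1" by (auto simp: eventually_sequentially)
  then show ?thesis using assms by (auto simp: power_divide field_simps intro!: exI[of _ k])
qed

text \<open>An algebraic integer all of whose conjugates have absolute value less than 1 vanishes.\<close>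

lemma bounded_int_eq_0:
  fixes h :: "'a::field_char_0"
  assumes "bounded_int R (of_nat m * h)" "bounded_int Y h" "R < real m"
  shows "h = 0"
proof -
  interpret Q: vector_space "\<lambda>q x. of_rat q * (x :: 'a)" by (rule vector_space_of_rat)
  obtain V C where V: "finite V" "C \<ge> 0" "\<And>k. (of_nat m * h) ^ k \<in> zspan V (C * R ^ k)" "R \<ge> 0"
    using assms(1) unfolding bounded_int_def by blast
  obtain W C' where W: "finite W" "C' \<ge> 0" "\<And>k. h ^ k \<in> zspan W (C' * Y ^ k)" "Y \<ge> 0"
    using assms(2) unfolding bounded_int_def by blast
  obtain B where B: "B \<subseteq> V \<union> W" "Q.independent B" "V \<union> W \<subseteq> Q.span B"
    using Q.maximal_independent_subset[of "V \<union> W"] by blast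
  have finB: "finite B" using B V W by (meson finite_Un finite_subset)
  define rep where "rep = Q.representation B"
  have rep_sum: "rep (\<Sum>v\<in>U. of_int (a v) * v) b = (\<Sum>v\<in>U. of_int (a v) * rep v b)"
    if "U \<subseteq> V \<union> W" for U a b
  proof -
    have U: "v \<in> Q.span B" if "v \<in> U" for v using that \<open>U \<subseteq> V \<union> W\<close> B by auto
    have "(\<Sum>v\<in>U. of_int (a v) * v) = (\<Sum>v\<in>U. of_rat (of_int (a v)) * v)" by simp
    also have "rep \<dots> b = (\<Sum>v\<in>U. rep (of_rat (of_int (a v)) * v) b)"
      unfolding rep_def by (subst Q.representation_sum[OF B(2) Q.span_scale[OF U]]) auto
    also have "\<dots> = (\<Sum>v\<in>U. of_int (a v) * rep v b)"
      unfolding rep_def by (intro sum.cong refl, subst Q.representation_scale[OF B(2)]) (use U in auto)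
    finally show ?thesis .
  qed
  \<comment> \<open>Integer combinations of \<open>W\<close> have coordinates in \<open>B\<close>
    whose denominators divide the fixed \<open>D\<close>; this covers all powers of \<open>h\<close>
    alike.\<close>
  obtain D where D: "D > 0" "\<And>w b. w \<in> W \<Longrightarrow> b \<in> B \<Longrightarrow> of_int D * rep w b \<in> \<int>"
    using common_denominator[of "(\<lambda>(w, b). rep w b) ` (W \<times> B)"] W finB by auto
  define M where "M = (\<Sum>v\<in>V. \<Sum>b\<in>B. \<bar>real_of_rat (rep v b)\<bar>)"
  have M: "\<bar>real_of_rat (rep v b)\<bar> \<le> M" if "v \<in> V" "b \<in> B" for v b
  proof -
    have "\<bar>real_of_rat (rep v b)\<bar> \<le> (\<Sum>b\<in>B. \<bar>real_of_rat (rep v b)\<bar>)"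
      using that finB by (intro member_le_sum) auto
    also have "\<dots> \<le> M" unfolding M_def using that V by (intro member_le_sum) (auto intro: sum_nonneg)
    finally show ?thesis .
  qed
  \<comment> \<open>For this \<open>k\<close> the coordinates of \<open>D * h ^ k\<close> are
    integers of absolute value below 1: those of \<open>m ^ k * h ^ k\<close> come from
    \<open>V\<close> and are at most \<open>M * C * R ^ k\<close>.\<close>
  obtain k where k: "(real_of_int D * (M * C)) * R ^ k < real m ^ k"
    using exists_power_dominated[OF V(4) assms(3)] by blast
  have span: "h ^ k \<in> Q.span B"
  proof -
    obtain a where "h ^ k = (\<Sum>v\<in>W. of_int (a v) * v)" using W(3)[of k] by (auto simp: zspan_def)
    then have "h ^ k = (\<Sum>v\<in>W. of_rat (of_int (a v)) * v)" by simp
    also have "\<dots> \<in> Q.span B" using B by (intro Q.span_sum Q.span_scale) auto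
    finally show ?thesis .
  qed
  have "rep (h ^ k) b = 0" if b: "b \<in> B" for b
  proof -
    obtain a where a: "h ^ k = (\<Sum>v\<in>W. of_int (a v) * v)" using W(3)[of k] by (auto simp: zspan_def)
    have int: "of_int D * rep (h ^ k) b \<in> \<int>"
    proof -
      have "of_int D * rep (h ^ k) b = (\<Sum>v\<in>W. of_int (a v) * (of_int D * rep v b))"
        unfolding a by (subst rep_sum) (auto simp: sum_distrib_left algebra_simps)
      also have "\<dots> \<in> \<int>" using b by (intro Ints_sum Ints_mult[OF Ints_of_int] D(2))
      finally show ?thesis .
    qed
    obtain a' where a': "(of_nat m * h) ^ k = (\<Sum>v\<in>V. of_int (a' v) * v)"
      "(\<Sum>v\<in>V. \<bar>real_of_int (a' v)\<bar>) \<le> C * R ^ k"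
      using V(3)[of k] by (auto simp: zspan_def)
    have "rep ((of_nat m * h) ^ k) b = of_nat (m ^ k) * rep (h ^ k) b"
      unfolding rep_def using Q.representation_scale[OF B(2) span, of "of_nat (m ^ k)"]
      by (simp add: power_mult_distrib of_rat_power)
    then have "real_of_rat (of_nat (m ^ k) * rep (h ^ k) b) = real_of_rat (\<Sum>v\<in>V. of_int (a' v) * rep v b)"
      using a'(1) rep_sum[of V a' b] by simp
    then have "real m ^ k * real_of_rat (rep (h ^ k) b) = (\<Sum>v\<in>V. real_of_int (a' v) * real_of_rat (rep v b))"
      by (simp add: of_rat_mult of_rat_sum of_rat_power)
    then have "real m ^ k * \<bar>real_of_rat (rep (h ^ k) b)\<bar> = \<bar>\<Sum>v\<in>V. real_of_int (a' v) * real_of_rat (rep v b)\<bar>"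
      by (metis abs_mult abs_of_nat of_nat_power)
    also have "\<dots> \<le> (\<Sum>v\<in>V. \<bar>real_of_int (a' v)\<bar> * M)"
      by (rule order_trans[OF sum_abs], rule sum_mono, unfold abs_mult) (intro mult_left_mono M b abs_ge_zero)
    also have "\<dots> \<le> C * R ^ k * M"
      unfolding sum_distrib_right[symmetric]
      by (intro mult_right_mono a') (auto simp: M_def intro!: sum_nonneg)
    finally have "real m ^ k * (D * \<bar>real_of_rat (rep (h ^ k) b)\<bar>) \<le> (real_of_int D * (M * C)) * R ^ k"
      using D(1) by (simp add: algebra_simps)
    also have "\<dots> < real m ^ k * 1" using k by simp
    finally have "D * \<bar>real_of_rat (rep (h ^ k) b)\<bar> < 1"
      using assms(3) V(4) by (subst (asm) mult_less_cancel_left_pos) auto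
    moreover obtain z where z: "of_int D * rep (h ^ k) b = of_int z" using int by (auto elim: Ints_cases)
    then have "real_of_int D * real_of_rat (rep (h ^ k) b) = real_of_int z"
      by (metis of_rat_mult of_rat_of_int_eq)
    then have "D * \<bar>real_of_rat (rep (h ^ k) b)\<bar> = \<bar>real_of_int z\<bar>"
      using D(1) by (simp flip: \<open>real_of_int D * real_of_rat (rep (h ^ k) b) = real_of_int z\<close> add: abs_mult)
    ultimately have "z = 0" by linarith
    then show ?thesis using z D by simp
  qed
  moreover have "(\<Sum>b\<in>B. of_rat (rep (h ^ k) b) * b) = h ^ k"
    unfolding rep_def by (rule Q.sum_representation_eq[OF B(2) span finB]) auto
  ultimately show ?thesis by simp
qed

section \<open>Pigeonhole for expansions in base \<open>m\<close>\<close>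

lemma sum_lessThan_add:
  fixes f :: "nat \<Rightarrow> 'a::comm_monoid_add"
  shows "(\<Sum>i<a + b. f i) = (\<Sum>i<a. f i) + (\<Sum>i<b. f (a + i))"
  by (induction b) (simp_all add: add.assoc)

text \<open>Compare the number of base \<open>m\<close> expansions with digits in \<open>S\<close> to the number of lattice points of
  their size; at the first digit where two equal expansions differ, the difference is divisible by \<open>m\<close>.\<close>

lemma digit_pigeonhole:
  fixes S :: "'a::field_char_0 set" and \<beta> :: "'i \<Rightarrow> 'a"
  assumes S: "finite S" and I: "finite I" and m: "m \<ge> 2"
    and comb: "\<And>s. s \<in> S \<Longrightarrow> \<exists>z::'i \<Rightarrow> int. s = (\<Sum>i\<in>I. of_int (z i) * \<beta> i)"
    and card: "card S > m ^ card I"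
  obtains s t and L :: nat and u u' where "s \<in> S" "t \<in> S" "s \<noteq> t" "\<And>l. l < L \<Longrightarrow> u l \<in> S" "\<And>l. l < L \<Longrightarrow> u' l \<in> S"
    "s - t = of_nat m * (\<Sum>l<L. of_nat m ^ l * (u l - u' l))"
proof -
  obtain z :: "'a \<Rightarrow> 'i \<Rightarrow> int" where z: "\<And>s. s \<in> S \<Longrightarrow> s = (\<Sum>i\<in>I. of_int (z s i) * \<beta> i)"
    using comb by metis
  define Z where "Z = (\<Sum>s\<in>S. \<Sum>i\<in>I. \<bar>z s i\<bar>)"
  have Z0: "Z \<ge> 0" unfolding Z_def by (intro sum_nonneg) auto
  have Z: "\<bar>z s i\<bar> \<le> Z" if "s \<in> S" "i \<in> I" for s i
  proof -
    have "\<bar>z s i\<bar> \<le> (\<Sum>i\<in>I. \<bar>z s i\<bar>)" using that I by (intro member_le_sum) auto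
    also have "\<dots> \<le> Z" unfolding Z_def using that S by (intro member_le_sum) (auto intro: sum_nonneg)
    finally show ?thesis .
  qed
  \<comment> \<open>There are \<open>card S ^ k\<close> digit strings of length \<open>k\<close>,
    and their coordinate vectors lie in a box of at most
    \<open>nat (2 * Z + 1) ^ card I * (m ^ card I) ^ k\<close> lattice points. For this
    \<open>k\<close> the strings outnumber the points.\<close>
  obtain k where k: "real (nat (2 * Z + 1) ^ card I) * real (m ^ card I) ^ k < real (card S) ^ k"
    using exists_power_dominated[of "real (m ^ card I)" "real (card S)"] card by (metis of_nat_0_le_iff of_nat_less_iff)
  define G where "G = ({..<k} \<rightarrow>\<^sub>E S)"
  \<comment> \<open>Coordinates of the value of a digit string. Equal coordinates give equal values,
    whether or not the \<beta> are linearly independent.\<close>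
  define \<Phi> where "\<Phi> = (\<lambda>g. \<lambda>i\<in>I. \<Sum>j<k. int m ^ j * z (g j) i)"
  define T where "T = (I \<rightarrow>\<^sub>E {- Z * int m ^ k .. Z * int m ^ k})"
  have "\<Phi> ` G \<subseteq> T"
  proof
    fix y assume "y \<in> \<Phi> ` G"
    then obtain g where g: "g \<in> G" "y = \<Phi> g" by auto
    have "\<bar>\<Sum>j<k. int m ^ j * z (g j) i\<bar> \<le> Z * int m ^ k" if i: "i \<in> I" for i
    proof -
      have "\<bar>\<Sum>j<k. int m ^ j * z (g j) i\<bar> \<le> (\<Sum>j<k. \<bar>int m ^ j * z (g j) i\<bar>)"
        by (rule sum_abs)
      also have "\<dots> \<le> (\<Sum>j<k. int m ^ j * Z)"
      proof (rule sum_mono)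
        fix j assume "j \<in> {..<k}"
        then have "\<bar>z (g j) i\<bar> \<le> Z" using g i by (intro Z) (auto simp: G_def)
        then show "\<bar>int m ^ j * z (g j) i\<bar> \<le> int m ^ j * Z" by (simp add: abs_mult mult_left_mono)
      qed
      also have "\<dots> = Z * (\<Sum>j<k. int m ^ j)" by (simp add: sum_distrib_left mult.commute)
      also have "(\<Sum>j<k. int m ^ j) \<le> int m ^ k"
      proof (induction k)
        case (Suc k)
        have "(\<Sum>j<Suc k. int m ^ j) \<le> 2 * int m ^ k" using Suc by simp
        also have "\<dots> \<le> int m ^ Suc k" using m by (simp add: mult_right_mono)
        finally show ?case .
      qed simp
      finally show ?thesis using Z0 by (simp add: mult_left_mono)
    qed
    then show "y \<in> T" unfolding g T_def \<Phi>_def by (auto simp: abs_le_iff minus_le_iff)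
  qed
  moreover have "finite T" unfolding T_def using I by (intro finite_PiE) auto
  ultimately have "card (\<Phi> ` G) \<le> card T" by (rule card_mono[rotated])
  moreover have "card T < card G"
  proof -
    have "card T = nat (2 * Z * int m ^ k + 1) ^ card I"
      unfolding T_def using I Z0 by (simp add: card_PiE algebra_simps)
    also have "\<dots> \<le> (nat (2 * Z + 1) * m ^ k) ^ card I"
    proof (rule power_mono)
      have "2 * Z * int m ^ k + 1 \<le> (2 * Z + 1) * int m ^ k" using m by (simp add: algebra_simps)
      then have "nat (2 * Z * int m ^ k + 1) \<le> nat ((2 * Z + 1) * int m ^ k)" by (rule nat_mono)
      also have "\<dots> = nat (2 * Z + 1) * m ^ k"
        using Z0 by (simp add: nat_mult_distrib nat_power_eq)
      finally show "nat (2 * Z * int m ^ k + 1) \<le> nat (2 * Z + 1) * m ^ k" .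
    qed simp
    also have "\<dots> = nat (2 * Z + 1) ^ card I * (m ^ card I) ^ k"
      by (simp add: power_mult_distrib flip: power_mult) (simp add: mult.commute)
    also have "\<dots> < card S ^ k"
      using k by (simp flip: of_nat_power of_nat_mult)
    also have "\<dots> = card G" unfolding G_def using S by (simp add: card_PiE)
    finally show ?thesis .
  qed
  ultimately have "card (\<Phi> ` G) < card G" by simp
  then have "\<not> inj_on \<Phi> G" using pigeonhole by blast
  then obtain g g' where g: "g \<in> G" "g' \<in> G" "g \<noteq> g'" "\<Phi> g = \<Phi> g'" unfolding inj_on_def by blast
  have gS: "g j \<in> S" "g' j \<in> S" if "j < k" for j using g that by (auto simp: G_def)
  have val: "(\<Sum>j<k. of_nat m ^ j * h j) = (\<Sum>i\<in>I. of_int (\<Phi> h i) * \<beta> i)" if "h \<in> G" for h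
  proof -
    have "(\<Sum>j<k. of_nat m ^ j * h j) = (\<Sum>j<k. of_nat m ^ j * (\<Sum>i\<in>I. of_int (z (h j) i) * \<beta> i))"
      by (intro sum.cong refl arg_cong2[where f = "(*)"] z) (use that in \<open>auto simp: G_def\<close>)
    also have "\<dots> = (\<Sum>i\<in>I. of_int (\<Phi> h i) * \<beta> i)"
      unfolding \<Phi>_def by (simp add: sum_distrib_left sum_distrib_right sum.swap[of _ I] mult.assoc)
    finally show ?thesis .
  qed
  have eq: "(\<Sum>j<k. of_nat m ^ j * (g j - g' j)) = 0"
    using val[OF g(1)] val[OF g(2)] g(4) by (simp add: algebra_simps sum_subtractf)
  have "\<exists>j<k. g j \<noteq> g' j" using g(1-3) unfolding G_def by (metis PiE_ext lessThan_iff)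
  define j where "j = (LEAST j. j < k \<and> g j \<noteq> g' j)"
  have j: "j < k" "g j \<noteq> g' j" using LeastI_ex[OF \<open>\<exists>j<k. g j \<noteq> g' j\<close>] by (auto simp: j_def)
  have lt: "g i = g' i" if "i < j" for i
    using not_less_Least[of i "\<lambda>j. j < k \<and> g j \<noteq> g' j"] that j by (auto simp: j_def)
  have aux: "x = c * s'" if "x + c * s = 0" "s' = - s" for x c s s' :: 'a
    using that by (simp add: add_eq_0_iff)
  define L where "L = k - Suc j"
  have "0 = (\<Sum>i<j + Suc L. of_nat m ^ i * (g i - g' i))" using eq j by (simp add: L_def)
  also have "\<dots> = (\<Sum>i<j. of_nat m ^ i * (g i - g' i)) + (\<Sum>i<Suc L. of_nat m ^ (j + i) * (g (j + i) - g' (j + i)))"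
    by (rule sum_lessThan_add)
  also have "(\<Sum>i<j. of_nat m ^ i * (g i - g' i)) = 0" using lt by (intro sum.neutral) auto
  also have "(\<Sum>i<Suc L. of_nat m ^ (j + i) * (g (j + i) - g' (j + i))) =
      of_nat m ^ j * (\<Sum>i<Suc L. of_nat m ^ i * (g (j + i) - g' (j + i)))"
    by (simp add: power_add sum_distrib_left algebra_simps)
  also have "(\<Sum>i<Suc L. of_nat m ^ i * (g (j + i) - g' (j + i))) =
      (g j - g' j) + of_nat m * (\<Sum>i<L. of_nat m ^ i * (g (j + Suc i) - g' (j + Suc i)))"
    by (subst sum.lessThan_Suc_shift) (simp add: sum_distrib_left mult.assoc)
  finally have "(g j - g' j) + of_nat m * (\<Sum>i<L. of_nat m ^ i * (g (j + Suc i) - g' (j + Suc i))) = 0"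
    using m by simp
  \<comment> \<open>Moving the tail to the other side swaps the two strings: the digits
    \<open>u\<close> will come from \<open>g'\<close> and the digits \<open>u'\<close> from
    \<open>g\<close>.\<close>
  moreover have "(\<Sum>i<L. of_nat m ^ i * (g' (j + Suc i) - g (j + Suc i))) =
      - (\<Sum>i<L. of_nat m ^ i * (g (j + Suc i) - g' (j + Suc i)))"
    unfolding sum_negf[symmetric] by (intro sum.cong refl) (simp add: algebra_simps)
  ultimately have "g j - g' j = of_nat m * (\<Sum>i<L. of_nat m ^ i * (g' (j + Suc i) - g (j + Suc i)))"
    by (rule aux)
  then show ?thesis
    by (rule that[OF gS(1)[OF j(1)] gS(2)[OF j(1)] j(2), rotated 2]) (auto simp: L_def intro!: gS)
qed

section \<open>Clearing denominators in the number field\<close>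

lemma zspan_to_ac:
  assumes "x \<in> zspan V r"
  shows "to_ac x \<in> zspan (to_ac ` V) r"
proof -
  obtain a where a: "x = (\<Sum>v\<in>V. of_int (a v) * v)" "(\<Sum>v\<in>V. \<bar>real_of_int (a v)\<bar>) \<le> r"
    using assms by (auto simp: zspan_def)
  show ?thesis
    unfolding zspan_def
    by (rule CollectI, rule exI[of _ "\<lambda>v. a (of_ac v)"])
      (use a in \<open>auto simp: sum.reindex inj_on_def to_ac_sum\<close>)
qed

lemma bounded_int_to_ac:
  assumes "bounded_int r x"
  shows "bounded_int r (to_ac x)"
proof (rule bounded_intE[OF assms])
  fix V C assume *: "finite V" "C \<ge> 0" "\<And>k. x ^ k \<in> zspan V (C * r ^ k)" "r \<ge> 0"
  show ?thesis
    by (rule bounded_intI[of "to_ac ` V" C]) (use * zspan_to_ac[OF *(3)] in auto)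
qed

lemma number_field_basis:
  assumes "number_field TYPE('k::field_char_0)"
  obtains B :: "'k::field_char_0 set" where "finite B" "B \<noteq> {}"
    "\<And>x. \<exists>q. x = (\<Sum>b\<in>B. of_rat (q b) * b)"
    "\<And>q. (\<Sum>b\<in>B. of_rat (q b) * b) = 0 \<Longrightarrow> (\<forall>b\<in>B. q b = 0)"
proof -
  obtain B where "finite_dimensional_vector_space (\<lambda>(q::rat) (x::'k). of_rat q * x) B"
    using assms by (auto simp: number_field_def)
  then interpret F: finite_dimensional_vector_space "\<lambda>(q::rat) (x::'k). of_rat q * x" B .
  have 1: "\<exists>q. x = (\<Sum>b\<in>B. of_rat (q b) * b)" for x
    using F.span_Basis F.span_finite[OF F.finite_Basis] by auto
  have 2: "\<forall>b\<in>B. q b = 0" if "(\<Sum>b\<in>B. of_rat (q b) * b) = 0" for q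
    using F.independent_Basis that F.finite_Basis by (auto simp: F.dependent_finite)
  have "B \<noteq> {}" using 1[of 1] by auto
  with that F.finite_Basis 1 2 show ?thesis by blast
qed

text \<open>Multiplication by \<open>x\<close> is a rational matrix in a basis of the field.
  Clearing denominators makes it an integer matrix, whose entries control the growth of the
  powers.\<close>

lemma number_field_bounded_multiple:
  fixes x :: "'k::field_char_0"
  assumes "number_field TYPE('k)"
  shows "\<exists>D r. D > 0 \<and> bounded_int r (of_int D * x)"
proof -
  obtain B :: "'k set" where B: "finite B" "B \<noteq> {}" "\<And>x. \<exists>q. x = (\<Sum>b\<in>B. of_rat (q b) * b)"
    "\<And>q. (\<Sum>b\<in>B. of_rat (q b) * b) = 0 \<Longrightarrow> (\<forall>b\<in>B. q b = 0)"
    using number_field_basis[OF assms] by metis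
  obtain b0 where b0: "b0 \<in> B" using B by auto
  have b00: "b0 \<noteq> 0"
  proof
    assume "b0 = 0"
    then have "(\<Sum>b\<in>B. of_rat (if b = b0 then 1 else 0) * b) = 0" by (intro sum.neutral) auto
    from B(4)[OF this] b0 show False by auto
  qed
  have "\<forall>b. \<exists>q. x * b = (\<Sum>b'\<in>B. of_rat (q b') * b')" using B(3) by blast
  then obtain q where q: "\<And>b. x * b = (\<Sum>b'\<in>B. of_rat (q b b') * b')" by metis
  obtain D where D: "D > 0" "\<And>b b'. b \<in> B \<Longrightarrow> b' \<in> B \<Longrightarrow> of_int D * q b b' \<in> \<int>"
    using common_denominator[of "(\<lambda>(b, b'). q b b') ` (B \<times> B)"] B(1) by auto
  then have "\<forall>b\<in>B. \<forall>b'\<in>B. \<exists>a. of_int D * q b b' = of_int a" by (metis Ints_cases)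
  then obtain a where a: "\<And>b b'. b \<in> B \<Longrightarrow> b' \<in> B \<Longrightarrow> of_int D * q b b' = of_int (a b b')" by metis
  have xa: "(of_int D * x) * b = (\<Sum>b'\<in>B. of_int (a b b') * b')" if "b \<in> B" for b
  proof -
    have "(of_int D * x) * b = (\<Sum>b'\<in>B. of_rat (of_int D * q b b') * b')"
      by (simp add: mult.assoc q sum_distrib_left of_rat_mult)
    also have "\<dots> = (\<Sum>b'\<in>B. of_int (a b b') * b')" using a that by (intro sum.cong) auto
    finally show ?thesis .
  qed
  define A where "A = (\<Sum>b\<in>B. \<Sum>b'\<in>B. \<bar>real_of_int (a b b')\<bar>)"
  have A0: "A \<ge> 0" unfolding A_def by (intro sum_nonneg) auto
  have A: "(\<Sum>b'\<in>B. \<bar>real_of_int (a b b')\<bar>) \<le> A" if "b \<in> B" for b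
    unfolding A_def using that B by (intro member_le_sum[of b B "\<lambda>b. \<Sum>b'\<in>B. \<bar>real_of_int (a b b')\<bar>"]) (auto intro: sum_nonneg)
  have pow: "(of_int D * x) ^ k * b \<in> zspan B (A ^ k)" if "b \<in> B" for b k
    using that
  proof (induction k arbitrary: b)
    case 0
    then show ?case using B by (auto intro: zspan_base)
  next
    case (Suc k)
    have "(of_int D * x) ^ Suc k * b = (of_int D * x) ^ k * (\<Sum>b'\<in>B. of_int (a b b') * b')"
      unfolding xa[OF Suc.prems, symmetric] by (simp add: mult.assoc mult.left_commute)
    also have "\<dots> = (\<Sum>b'\<in>B. of_int (a b b') * ((of_int D * x) ^ k * b'))"
      by (simp add: sum_distrib_left algebra_simps)
    also have "\<dots> \<in> zspan B (\<Sum>b'\<in>B. \<bar>real_of_int (a b b')\<bar> * A ^ k)"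
      using B Suc by (intro zspan_sum zspan_scale) auto
    finally show ?case
      by (rule zspan_mono) (use A[OF Suc.prems] A0 in \<open>simp flip: sum_distrib_right add: mult_right_mono\<close>)
  qed
  have "bounded_int A (of_int D * x)"
  \<comment> \<open>The matrix argument controls the powers times \<open>b0\<close>; dividing by
    \<open>b0\<close> replaces \<open>B\<close> by the set of quotients
    \<open>b / b0\<close>.\<close>
  proof (rule bounded_intI[of "(\<lambda>(v, w). v * w) ` (B \<times> {1 / b0})" 1])
    fix k
    have "((of_int D * x) ^ k * b0) * (1 / b0) \<in> zspan ((\<lambda>(v, w). v * w) ` (B \<times> {1 / b0})) (A ^ k * 1)"
      using B A0 pow[OF b0] by (intro zspan_mult zspan_base) auto
    then show "(of_int D * x) ^ k \<in> zspan ((\<lambda>(v, w). v * w) ` (B \<times> {1 / b0})) (1 * A ^ k)"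
      using b00 by simp
  qed (use B A0 in auto)
  then show ?thesis using D by blast
qed

lemma common_bounded_multiple:
  fixes A :: "'a::field_char_0 set"
  assumes "finite A" "\<And>x. x \<in> A \<Longrightarrow> \<exists>D r. D > 0 \<and> bounded_int r (of_int D * x)"
  shows "\<exists>D r. D > 0 \<and> r \<ge> 1 \<and> (\<forall>x\<in>A. bounded_int r (of_int D * x))"
  using assms
proof (induction A rule: finite_induct)
  case empty
  then show ?case by (auto intro: exI[of _ 1])
next
  case (insert y A)
  obtain D r where D: "D > 0" "r \<ge> 1" "\<And>x. x \<in> A \<Longrightarrow> bounded_int r (of_int D * x)"
    using insert by auto
  obtain D' r' where D': "D' > 0" "bounded_int r' (of_int D' * y)" using insert by blast
  let ?r = "\<bar>real_of_int D'\<bar> * r + \<bar>real_of_int D\<bar> * r'"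
  have r': "r' \<ge> 0" using D'(2) by (rule bounded_int_nonneg)
  have "bounded_int ?r (of_int (D' * D) * x)" if "x \<in> A" for x
    by (rule bounded_int_mono[of "\<bar>real_of_int D'\<bar> * r"])
      (use bounded_int_scale[OF D(3)[OF that], of D'] r' in \<open>auto simp: algebra_simps\<close>)
  moreover have "bounded_int ?r (of_int (D' * D) * y)"
    by (rule bounded_int_mono[of "\<bar>real_of_int D\<bar> * r'"])
      (use bounded_int_scale[OF D'(2), of D] D in \<open>auto simp: algebra_simps\<close>)
  ultimately have "\<forall>x\<in>insert y A. bounded_int (max 1 ?r) (of_int (D' * D) * x)"
    by (metis insert_iff bounded_int_mono max.cobounded2)
  then show ?case using D D' by (intro exI[of _ "D' * D"] exI[of _ "max 1 ?r"]) auto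
qed

text \<open>A Dirichlet-type box argument. Small combinations \<open>lc p\<close>,
  \<open>lc q\<close> of a basis give \<open>(H + 1) ^ (2 * n)\<close> sums
  \<open>lc p * w + lc q * u\<close>, all of rate \<open>Y\<close> and all in \<open>w\<close> times
  the number field, a rational space of dimension \<open>n\<close>. If they were distinct, the digit
  pigeonhole would give a nonzero difference divisible by \<open>m\<close> but of rate below
  \<open>m\<close>. So two sums agree, and \<kappa> is a quotient of combinations with coefficients
  of size at most \<open>H\<close>, where \<open>H\<close> depends only on \<open>R\<close> and the
  field.\<close>

lemma finite_bounded_quotients:
  assumes "number_field TYPE('k::field_char_0)"
  shows "finite {\<kappa>::'k::field_char_0. \<exists>u w. w \<noteq> 0 \<and> bounded_int R u \<and> bounded_int R w \<and> to_ac \<kappa> * w = u}"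
proof -
  obtain B :: "'k set" where B: "finite B" "B \<noteq> {}" "\<And>x. \<exists>q. x = (\<Sum>b\<in>B. of_rat (q b) * b)"
    "\<And>q. (\<Sum>b\<in>B. of_rat (q b) * b) = 0 \<Longrightarrow> (\<forall>b\<in>B. q b = 0)"
    using number_field_basis[OF assms] by metis
  obtain D c where D: "D > 0" "c \<ge> 1" "\<And>b. b \<in> B \<Longrightarrow> bounded_int c (of_int D * b)"
    using common_bounded_multiple[of B] B number_field_bounded_multiple[OF assms] by metis
  define \<omega> where "\<omega> = (\<lambda>b::'k. of_int D * b)"
  define lc where "lc = (\<lambda>p::'k \<Rightarrow> int. \<Sum>b\<in>B. of_int (p b) * \<omega> b)"
  define n where "n = card B"
  have n: "n \<ge> 1" using B by (simp add: n_def Suc_le_eq card_gt_0_iff)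
  \<comment> \<open>Large enough that \<open>Y + Y < m\<close> for \<open>m = H * (H + 1)\<close>,
    while \<open>m ^ n\<close> stays below the number \<open>(H + 1) ^ (2 * n)\<close> of sums; the
    summand 2 gives \<open>H \<ge> 2\<close>.\<close>
  define H where "H = nat \<lceil>4 * real n * c * \<bar>R\<bar>\<rceil> + 2"
  have H: "4 * real n * c * \<bar>R\<bar> < real H" "H \<ge> 2" unfolding H_def by linarith+
  define m where "m = H * (H + 1)"
  define P where "P = (B \<rightarrow>\<^sub>E {0..int H})"
  define F where "F = (B \<rightarrow>\<^sub>E {- int H..int H})"
  have finF: "finite F" unfolding F_def using B by (intro finite_PiE) auto
  have cardP: "card P = (H + 1) ^ n" unfolding P_def n_def using B by (simp add: card_PiE nat_add_distrib)
  have finP: "finite P" unfolding P_def using B by (intro finite_PiE) auto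
  have lc0: "\<forall>b\<in>B. p b = 0" if "lc p = 0" for p
  proof -
    have "(\<Sum>b\<in>B. of_rat (of_int (p b * D)) * b) = 0"
      using that unfolding lc_def \<omega>_def by (simp add: of_rat_mult algebra_simps)
    from B(4)[OF this] show ?thesis using D by simp
  qed
  have lc_bdd: "bounded_int (real n * (real H * c)) (to_ac (lc p))" if "p \<in> P" for p
  proof -
    have "bounded_int (\<Sum>b\<in>B. real H * c) (lc p)"
      unfolding lc_def
    proof (rule bounded_int_sum[OF B(1)])
      fix b assume b: "b \<in> B"
      have "\<bar>real_of_int (p b)\<bar> \<le> real H" using that b by (auto simp: P_def PiE_iff)
      then have "\<bar>real_of_int (p b)\<bar> * c \<le> real H * c" using D by (intro mult_right_mono) auto
      then show "bounded_int (real H * c) (of_int (p b) * \<omega> b)"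
        using bounded_int_mono[OF bounded_int_scale[OF D(3)[OF b]]] unfolding \<omega>_def by blast
    qed
    then show ?thesis using bounded_int_to_ac by (simp add: n_def)
  qed
  have "{\<kappa>::'k. \<exists>u w. w \<noteq> 0 \<and> bounded_int R u \<and> bounded_int R w \<and> to_ac \<kappa> * w = u}
      \<subseteq> (\<lambda>(p, q). lc p / lc q) ` (F \<times> F)"
  proof safe
    fix \<kappa> :: 'k and w :: "'k alg_closure"
    assume w: "w \<noteq> 0" "bounded_int R (to_ac \<kappa> * w)" "bounded_int R w"
    define s where "s = (\<lambda>(p, q). to_ac (lc p) * w + to_ac (lc q) * (to_ac \<kappa> * w))"
    have R: "R \<ge> 0" using w bounded_int_nonneg by blast
    define Y where "Y = 2 * (real n * (real H * c) * R)"
    have s_bdd: "bounded_int Y (s pq)" if "pq \<in> P \<times> P" for pq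
      using bounded_int_add[OF bounded_int_mult[OF lc_bdd[of "fst pq"] w(3)] bounded_int_mult[OF lc_bdd[of "snd pq"] w(2)]] that
      unfolding Y_def mult_2 by (auto simp: s_def)
    have Ym: "Y + Y < real m"
    proof -
      have "Y + Y = (4 * real n * c * R) * real H" by (simp add: Y_def)
      also have "\<dots> \<le> real H * real H" using H R by (intro mult_right_mono) auto
      also have "\<dots> < real m" unfolding m_def using H by (simp add: algebra_simps)
      finally show ?thesis .
    qed
    have "\<not> inj_on s (P \<times> P)"
    proof
      assume inj: "inj_on s (P \<times> P)"
      define S where "S = s ` (P \<times> P)"
      have finS: "finite S" unfolding S_def using finP by auto
      have "card S = (H + 1) ^ n * (H + 1) ^ n"
        unfolding S_def using inj by (simp add: card_image card_cartesian_product cardP)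
      moreover have "m ^ card B < (H + 1) ^ n * (H + 1) ^ n"
        unfolding m_def n_def[symmetric] power_mult_distrib
        using n by (intro mult_strict_right_mono power_strict_mono) auto
      ultimately have cardS: "card S > m ^ card B" by simp
      define f where "f = (\<lambda>(p, q). lc p + lc q * \<kappa>)"
      have sf: "s pq = to_ac (f pq) * w" for pq
        by (auto simp: s_def f_def algebra_simps split: prod.splits)
      have "\<forall>pq. \<exists>q. f pq = (\<Sum>b\<in>B. of_rat (q b) * b)" using B(3) by blast
      then obtain q where q: "\<And>pq. f pq = (\<Sum>b\<in>B. of_rat (q pq b) * b)" by metis
      obtain E where E: "E > 0" "\<And>pq b. pq \<in> P \<times> P \<Longrightarrow> b \<in> B \<Longrightarrow> of_int E * q pq b \<in> \<int>"
        using common_denominator[of "(\<lambda>(pq, b). q pq b) ` ((P \<times> P) \<times> B)"] B finP by force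
      \<comment> \<open>Since all sums lie in \<open>w\<close> times the field, they are integer
        combinations of only \<open>card B\<close> elements, whatever the degree of
        \<open>w\<close>.\<close>
      have comb: "\<exists>z::'k \<Rightarrow> int. y = (\<Sum>b\<in>B. of_int (z b) * (to_ac b * w / of_int E))" if "y \<in> S" for y
      proof -
        obtain pq where pq: "pq \<in> P \<times> P" "y = s pq" using \<open>y \<in> S\<close> S_def by auto
        have "\<forall>b\<in>B. \<exists>a. of_int E * q pq b = of_int a" using E(2)[OF pq(1)] by (metis Ints_cases)
        then obtain a where a: "\<And>b. b \<in> B \<Longrightarrow> of_int E * q pq b = of_int (a b)" by metis
        have "of_int E * f pq = (\<Sum>b\<in>B. of_rat (of_int E * q pq b) * b)"
          by (simp add: q sum_distrib_left of_rat_mult mult.assoc)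
        also have "\<dots> = (\<Sum>b\<in>B. of_int (a b) * b)" using a by (intro sum.cong) auto
        finally have "to_ac (of_int E * f pq) = to_ac (\<Sum>b\<in>B. of_int (a b) * b)" by simp
        then have "of_int E * to_ac (f pq) = (\<Sum>b\<in>B. of_int (a b) * to_ac b)" by (simp add: to_ac_sum)
        then have "to_ac (f pq) = (\<Sum>b\<in>B. of_int (a b) * to_ac b) / of_int E"
          using E(1) by (simp add: field_simps)
        then have "y = (\<Sum>b\<in>B. of_int (a b) * (to_ac b * w / of_int E))"
          unfolding pq sf by (simp add: sum_distrib_left sum_divide_distrib algebra_simps)
        then show ?thesis by blast
      qed
      have m2: "m \<ge> 2" unfolding m_def using H by (simp add: algebra_simps)
      show False
      proof (rule digit_pigeonhole[OF finS B(1) m2 comb cardS])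
        fix y t L u u'
        assume yt: "y \<in> S" "t \<in> S" "y \<noteq> t"
          and u: "\<And>l. l < L \<Longrightarrow> u l \<in> S" "\<And>l. l < L \<Longrightarrow> u' l \<in> S"
          and diff: "y - t = of_nat m * (\<Sum>l<L. of_nat m ^ l * (u l - u' l))"
        define h where "h = (\<Sum>l<L. of_nat m ^ l * (u l - u' l))"
        have S_bdd: "bounded_int Y v" if "v \<in> S" for v using that s_bdd by (auto simp: S_def)
        \<comment> \<open>For \<open>h\<close> itself any rate will do; the decisive small rate is
          that of \<open>m * h\<close>.\<close>
        have "bounded_int (\<Sum>l<L. \<bar>real_of_int (int m ^ l)\<bar> * (Y + Y)) (\<Sum>l<L. of_int (int m ^ l) * (u l - u' l))"
          by (intro bounded_int_sum bounded_int_scale bounded_int_diff S_bdd u) auto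
        then have "bounded_int (\<Sum>l<L. \<bar>real_of_int (int m ^ l)\<bar> * (Y + Y)) h" by (simp add: h_def)
        moreover have "bounded_int (Y + Y) (of_nat m * h)"
          unfolding h_def diff[symmetric] by (intro bounded_int_diff S_bdd yt)
        ultimately have "h = 0" using bounded_int_eq_0 Ym by blast
        then show False using diff yt by (simp add: h_def)
      qed
    qed
    then obtain p q p' q' where pq: "p \<in> P" "q \<in> P" "p' \<in> P" "q' \<in> P" "(p, q) \<noteq> (p', q')" "s (p, q) = s (p', q')"
      unfolding inj_on_def by auto
    have "to_ac ((lc p - lc p') + (lc q - lc q') * \<kappa>) * w = 0"
      using pq(6) by (simp add: s_def algebra_simps)
    then have eq: "(lc p - lc p') + (lc q - lc q') * \<kappa> = 0" using w(1) by (simp only: mult_eq_0_iff to_ac_eq_0_iff) simp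
    define a where "a = (\<lambda>b\<in>B. p' b - p b)"
    define b where "b = (\<lambda>b\<in>B. q b - q' b)"
    have sub: "(\<lambda>x\<in>B. f x - g x) \<in> F" if "f \<in> P" "g \<in> P" for f g
    proof -
      have "- int H \<le> f x - g x \<and> f x - g x \<le> int H" if "x \<in> B" for x
      proof -
        have "f x \<in> {0..int H}" "g x \<in> {0..int H}"
          using \<open>f \<in> P\<close> \<open>g \<in> P\<close> that unfolding P_def by (meson PiE_mem)+
        then show ?thesis by auto
      qed
      then show ?thesis unfolding F_def by auto
    qed
    then have ab: "a \<in> F" "b \<in> F" using pq unfolding a_def b_def by blast+
    have lca: "lc a = lc p' - lc p" and lcb: "lc b = lc q - lc q'"
      unfolding lc_def a_def b_def by (simp_all add: sum_subtractf algebra_simps cong: sum.cong)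
    \<comment> \<open>If \<open>lc b\<close> vanished, so would \<open>lc a\<close>, and
      independence of the basis would make the two pairs equal.\<close>
    have "lc b \<noteq> 0"
    proof
      assume b0: "lc b = 0"
      then have "lc a = 0" using eq lca lcb by simp
      have "p x = p' x" "q x = q' x" if "x \<in> B" for x
        using bspec[OF lc0[OF \<open>lc a = 0\<close>] that] bspec[OF lc0[OF b0] that] that
        by (simp_all add: a_def b_def)
      then have "p = p'" "q = q'" using pq(1-4) unfolding P_def by (blast intro: PiE_ext)+
      then show False using pq by simp
    qed
    moreover have "lc b * \<kappa> = lc a" using eq unfolding lca lcb by (simp add: add_eq_0_iff)
    ultimately have "\<kappa> = lc a / lc b" by (simp add: eq_divide_eq mult.commute)
    then show "\<kappa> \<in> (\<lambda>(p, q). lc p / lc q) ` (F \<times> F)" using ab by auto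
  qed
  then show ?thesis by (rule finite_subset) (use finF in auto)
qed

section \<open>The projective Nullstellensatz\<close>

text \<open>Forms are represented by the functions they induce. Over an infinite field this loses nothing, and
  specialising a variable is just evaluation.\<close>

inductive hompoly :: "'n set \<Rightarrow> nat \<Rightarrow> (('n \<Rightarrow> 'a::comm_ring_1) \<Rightarrow> 'a) \<Rightarrow> bool" for S where
  zero: "hompoly S d (\<lambda>_. 0)"
| const: "hompoly S 0 (\<lambda>_. c)"
| var: "i \<in> S \<Longrightarrow> hompoly S d f \<Longrightarrow> hompoly S (Suc d) (\<lambda>x. x i * f x)"
| add: "hompoly S d f \<Longrightarrow> hompoly S d g \<Longrightarrow> hompoly S d (\<lambda>x. f x + g x)"

section \<open>Closure properties of forms\<close>

lemma hompoly_mono: "hompoly S d f \<Longrightarrow> S \<subseteq> S' \<Longrightarrow> hompoly S' d f"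
  by (induction rule: hompoly.induct) (auto intro: hompoly.intros)

lemma hompoly_scale: "hompoly S d f \<Longrightarrow> hompoly S d (\<lambda>x. c * f x)"
proof (induction rule: hompoly.induct)
  case (var i d f)
  then show ?case using hompoly.var[of i S d "\<lambda>x. c * f x"] by (simp add: mult.left_commute)
qed (auto simp: distrib_left intro: hompoly.intros)

lemma hompoly_mult: "hompoly S d f \<Longrightarrow> hompoly S e g \<Longrightarrow> hompoly S (d + e) (\<lambda>x. f x * g x)"
proof (induction rule: hompoly.induct)
  case (var i d f)
  then show ?case using hompoly.var[of i S "d + e" "\<lambda>x. f x * g x"] by (simp add: mult.assoc)
qed (auto simp: distrib_right intro: hompoly.intros hompoly_scale)

lemma hompoly_sum: "finite I \<Longrightarrow> (\<And>i. i \<in> I \<Longrightarrow> hompoly S d (f i)) \<Longrightarrow> hompoly S d (\<lambda>x. \<Sum>i\<in>I. f i x)"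
  by (induction I rule: finite_induct) (auto intro: hompoly.intros)

lemma hompoly_power: "i \<in> S \<Longrightarrow> hompoly S k (\<lambda>x. x i ^ k)"
proof (induction k)
  case 0 show ?case using hompoly.const[of S 1] by simp
next
  case (Suc k) then show ?case using hompoly.var[of i S k "\<lambda>x. x i ^ k"] by simp
qed

lemma hompoly_prod:
  assumes "finite I" "\<And>i. i \<in> I \<Longrightarrow> hompoly S (d i) (f i)"
  shows "hompoly S (\<Sum>i\<in>I. d i) (\<lambda>x. \<Prod>i\<in>I. f i x)"
  using assms by (induction I rule: finite_induct) (auto intro: hompoly.const[of _ 1, simplified] hompoly_mult)

lemma hompoly_uminus: "hompoly S d f \<Longrightarrow> hompoly S d (\<lambda>x. - f x)"
  using hompoly_scale[of S d f "-1"] by simp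

lemma hompoly_diff: "hompoly S d f \<Longrightarrow> hompoly S d g \<Longrightarrow> hompoly S d (\<lambda>x. f x - g x)"
  using hompoly.add[of S d f "\<lambda>x. - g x"] hompoly_uminus[of S d g] by simp

lemma hompoly_homogeneous: "hompoly S d f \<Longrightarrow> f (\<lambda>i. c * x i) = c ^ d * f x"
  by (induction rule: hompoly.induct) (auto simp: algebra_simps)

lemma hompoly_vanish: "hompoly S d f \<Longrightarrow> d > 0 \<Longrightarrow> (\<And>i. i \<in> S \<Longrightarrow> x i = 0) \<Longrightarrow> f x = 0"
  by (induction rule: hompoly.induct) auto

lemma hompoly_cong: "hompoly S d f \<Longrightarrow> (\<And>i. i \<in> S \<Longrightarrow> x i = y i) \<Longrightarrow> f x = f y"
  by (induction rule: hompoly.induct) auto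

lemma hompoly_restrict_poly: "hompoly S d f \<Longrightarrow> \<exists>g. \<forall>t. f (a(v := t)) = poly g t"
proof (induction rule: hompoly.induct)
  case (zero d)
  show ?case by (rule exI[of _ 0]) simp
next
  case (const c)
  show ?case by (rule exI[of _ "[:c:]"]) simp
next
  case (var i d f)
  then obtain g where "\<forall>t. f (a(v := t)) = poly g t" by blast
  then show ?case by (intro exI[of _ "(if i = v then [:0, 1:] else [:a i:]) * g"]) (auto simp: fun_upd_def)
next
  case (add d f g)
  then obtain p q where "\<forall>t. f (a(v := t)) = poly p t" "\<forall>t. g (a(v := t)) = poly q t" by blast
  then show ?case by (intro exI[of _ "p + q"]) (auto simp: fun_upd_def)
qed

lemma hompoly_expand:
  assumes "hompoly S d f" "v \<in> S"
  shows "\<exists>r. (\<forall>l\<le>d. hompoly (S - {v}) (d - l) (r l)) \<and> (\<forall>x. f x = (\<Sum>l\<le>d. r l x * x v ^ l))"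
  using assms
proof (induction rule: hompoly.induct)
  case (zero d)
  show ?case by (rule exI[of _ "\<lambda>_ _. 0"]) (auto intro: hompoly.zero)
next
  case (const c)
  show ?case by (rule exI[of _ "\<lambda>_ _. c"]) (auto intro: hompoly.const)
next
  case (var i d f)
  then obtain r where r: "\<And>l. l \<le> d \<Longrightarrow> hompoly (S - {v}) (d - l) (r l)" "\<And>x. f x = (\<Sum>l\<le>d. r l x * x v ^ l)"
    by blast
  show ?case
  proof (cases "i = v")
    case True
    show ?thesis
    proof (intro exI[of _ "\<lambda>l. case l of 0 \<Rightarrow> (\<lambda>_. 0) | Suc l \<Rightarrow> r l"] conjI allI impI)
      fix l assume "l \<le> Suc d"
      then show "hompoly (S - {v}) (Suc d - l) (case l of 0 \<Rightarrow> (\<lambda>_. 0) | Suc l \<Rightarrow> r l)"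
        using r(1) by (auto intro: hompoly.zero split: nat.splits)
    next
      fix x
      show "x i * f x = (\<Sum>l\<le>Suc d. (case l of 0 \<Rightarrow> \<lambda>_. 0 | Suc l \<Rightarrow> r l) x * x v ^ l)"
        by (simp add: sum.atMost_Suc_shift r(2) True sum_distrib_left algebra_simps del: sum.atMost_Suc)
    qed
  next
    case False
    show ?thesis
    proof (intro exI[of _ "\<lambda>l. if l \<le> d then (\<lambda>x. x i * r l x) else (\<lambda>_. 0)"] conjI allI impI)
      fix l assume "l \<le> Suc d"
      then show "hompoly (S - {v}) (Suc d - l) (if l \<le> d then \<lambda>x. x i * r l x else (\<lambda>_. 0))"
        using r(1)[of l] False var.hyps by (auto simp: Suc_diff_le intro!: hompoly.var hompoly.zero)
    qed (auto simp: r(2) sum_distrib_left algebra_simps)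
  qed
next
  case (add d f g)
  then obtain r s where
    "\<And>l. l \<le> d \<Longrightarrow> hompoly (S - {v}) (d - l) (r l)" "\<And>x. f x = (\<Sum>l\<le>d. r l x * x v ^ l)"
    "\<And>l. l \<le> d \<Longrightarrow> hompoly (S - {v}) (d - l) (s l)" "\<And>x. g x = (\<Sum>l\<le>d. s l x * x v ^ l)"
    by blast
  then show ?case
    by (intro exI[of _ "\<lambda>l x. r l x + s l x"]) (auto simp: algebra_simps sum.distrib intro: hompoly.add)
qed

lemma hompoly_0_const: "hompoly S 0 f \<Longrightarrow> f x = f y"
proof -
  have "hompoly S d f \<Longrightarrow> d = 0 \<longrightarrow> (\<forall>x y. f x = f y)" for d
    by (induction rule: hompoly.induct) (auto, metis)
  then show "hompoly S 0 f \<Longrightarrow> f x = f y" by blast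
qed

section \<open>Coefficients of a form\<close>

lemma finite_exponents: "finite {m :: 'n::finite \<Rightarrow> nat. (\<Sum>i\<in>UNIV. m i) = d}"
proof (rule finite_subset)
  show "{m :: 'n \<Rightarrow> nat. (\<Sum>i\<in>UNIV. m i) = d} \<subseteq> (UNIV \<rightarrow>\<^sub>E {..d})"
    by (auto simp: PiE_iff intro: member_le_sum)
  show "finite ((UNIV :: 'n set) \<rightarrow>\<^sub>E {..d})" by (intro finite_PiE) auto
qed

text \<open>Recovers coefficients from the function: rewriting by relations needs explicit sums of
  monomials with finitely many coefficients.\<close>

lemma hompoly_monomials:
  fixes f :: "('n::finite \<Rightarrow> 'a::comm_ring_1) \<Rightarrow> 'a"
  assumes "hompoly S d f"
  shows "\<exists>c. \<forall>x. f x = (\<Sum>m | (\<Sum>i\<in>UNIV. m i) = d. c m * (\<Prod>i\<in>UNIV. x i ^ m i))"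
  using assms
proof (induction rule: hompoly.induct)
  case (zero d)
  show ?case by (rule exI[of _ "\<lambda>_. 0"]) auto
next
  case (const c)
  have "{m :: 'n \<Rightarrow> nat. (\<Sum>i\<in>UNIV. m i) = 0} = {\<lambda>_. 0}" by auto
  then show ?case by (intro exI[of _ "\<lambda>_. c"]) simp
next
  case (var i d f)
  then obtain c where c: "\<And>x. f x = (\<Sum>m | (\<Sum>i\<in>UNIV. m i) = d. c m * (\<Prod>i\<in>UNIV. x i ^ m i))" by blast
  define up where "up = (\<lambda>m::'n \<Rightarrow> nat. m(i := Suc (m i)))"
  define dn where "dn = (\<lambda>m::'n \<Rightarrow> nat. m(i := m i - 1))"
  have dnup: "dn (up m) = m" for m by (auto simp: up_def dn_def)
  have up_pos: "up m i > 0" for m by (simp add: up_def)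
  have upsum: "(\<Sum>l\<in>UNIV. up m l) = Suc (\<Sum>l\<in>UNIV. m l)" for m
    by (simp add: up_def sum.remove[of UNIV i])
  have upprod: "(\<Prod>l\<in>UNIV. x l ^ up m l) = x i * (\<Prod>l\<in>UNIV. x l ^ m l)" for x :: "'n \<Rightarrow> 'a" and m
    by (simp add: up_def prod.remove[of UNIV i] mult.assoc)
  show ?case
  \<comment> \<open>Only monomials divisible by the new variable occur in the product; the others
    get coefficient 0, since \<open>dn\<close> does not invert \<open>up\<close> there.\<close>
  proof (intro exI[of _ "\<lambda>m. if m i > 0 then c (dn m) else 0"] allI)
    fix x :: "'n \<Rightarrow> 'a"
    have "x i * f x = (\<Sum>m | (\<Sum>l\<in>UNIV. m l) = d. c m * (\<Prod>l\<in>UNIV. x l ^ up m l))"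
      unfolding c upprod by (simp add: sum_distrib_left algebra_simps)
    also have "\<dots> = (\<Sum>m\<in>up ` {m. (\<Sum>l\<in>UNIV. m l) = d}. (if m i > 0 then c (dn m) else 0) * (\<Prod>l\<in>UNIV. x l ^ m l))"
      by (subst sum.reindex) (auto simp: dnup up_pos intro!: inj_on_inverseI[of _ dn])
    also have "\<dots> = (\<Sum>m | (\<Sum>l\<in>UNIV. m l) = Suc d. (if m i > 0 then c (dn m) else 0) * (\<Prod>l\<in>UNIV. x l ^ m l))"
    proof (rule sum.mono_neutral_left[OF finite_exponents])
      show "up ` {m. (\<Sum>l\<in>UNIV. m l) = d} \<subseteq> {m. (\<Sum>l\<in>UNIV. m l) = Suc d}" using upsum by auto
      show "\<forall>m\<in>{m. (\<Sum>l\<in>UNIV. m l) = Suc d} - up ` {m. (\<Sum>l\<in>UNIV. m l) = d}.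
          (if m i > 0 then c (dn m) else 0) * (\<Prod>l\<in>UNIV. x l ^ m l) = 0"
      proof
        fix m assume m: "m \<in> {m. (\<Sum>l\<in>UNIV. m l) = Suc d} - up ` {m. (\<Sum>l\<in>UNIV. m l) = d}"
        have "m i = 0"
        proof (rule ccontr)
          assume "m i \<noteq> 0"
          then have "m = up (dn m)" by (auto simp: up_def dn_def)
          moreover from this have "(\<Sum>l\<in>UNIV. dn m l) = d" using upsum[of "dn m"] m by simp
          ultimately show False using m by blast
        qed
        then show "(if m i > 0 then c (dn m) else 0) * (\<Prod>l\<in>UNIV. x l ^ m l) = 0" by simp
      qed
    qed
    finally show "x i * f x = (\<Sum>m | (\<Sum>l\<in>UNIV. m l) = Suc d. (if m i > 0 then c (dn m) else 0) * (\<Prod>l\<in>UNIV. x l ^ m l))" .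
  qed
next
  case (add d f g)
  then obtain c c' where "\<And>x. f x = (\<Sum>m | (\<Sum>i\<in>UNIV. m i) = d. c m * (\<Prod>i\<in>UNIV. x i ^ m i))"
    "\<And>x. g x = (\<Sum>m | (\<Sum>i\<in>UNIV. m i) = d. c' m * (\<Prod>i\<in>UNIV. x i ^ m i))" by blast
  then show ?case by (intro exI[of _ "\<lambda>m. c m + c' m"]) (simp add: sum.distrib distrib_right)
qed

text \<open>A homogeneous ideal, given by its graded pieces. The degree is an argument of membership
  because a function need not determine it: the zero function is a form of every degree.\<close>

definition graded_ideal :: "'n set \<Rightarrow> (nat \<Rightarrow> (('n \<Rightarrow> 'a::comm_ring_1) \<Rightarrow> 'a) \<Rightarrow> bool) \<Rightarrow> bool" where
  "graded_ideal S I \<longleftrightarrow>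
     (\<forall>d f. I d f \<longrightarrow> hompoly S d f) \<and> (\<forall>d. I d (\<lambda>_. 0)) \<and>
     (\<forall>d f g. I d f \<longrightarrow> I d g \<longrightarrow> I d (\<lambda>x. f x + g x)) \<and>
     (\<forall>d e f g. hompoly S e g \<longrightarrow> I d f \<longrightarrow> I (e + d) (\<lambda>x. g x * f x))"

lemma graded_idealD:
  assumes "graded_ideal S I"
  shows "I d f \<Longrightarrow> hompoly S d f" "I d (\<lambda>_. 0)" "I d f \<Longrightarrow> I d g \<Longrightarrow> I d (\<lambda>x. f x + g x)"
    "hompoly S e g \<Longrightarrow> I d f \<Longrightarrow> I (e + d) (\<lambda>x. g x * f x)"
  using assms unfolding graded_ideal_def by blast+

lemma graded_ideal_scale: "graded_ideal S I \<Longrightarrow> I d f \<Longrightarrow> I d (\<lambda>x. c * f x)"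
  using graded_idealD(4)[of S I 0 "\<lambda>_. c" d f] hompoly.const by auto

lemma graded_ideal_diff: "graded_ideal S I \<Longrightarrow> I d f \<Longrightarrow> I d g \<Longrightarrow> I d (\<lambda>x. f x - g x)"
  using graded_idealD(3)[of S I d f "\<lambda>x. -1 * g x"] graded_ideal_scale[of S I d g "-1"] by simp

text \<open>Gaussian elimination without division; the pivots are 1 at \<open>a\<close>.\<close>

lemma graded_ideal_eliminate:
  assumes I: "graded_ideal S I" and v: "v \<in> S"
    and "\<And>j. j \<le> n \<Longrightarrow> I (E j) (\<lambda>x. \<Sum>l\<le>n. c j l x * x v ^ l)"
    and "\<And>j l. j \<le> n \<Longrightarrow> l \<le> n \<Longrightarrow> hompoly (S - {v}) (E j - l) (c j l)"
    and "\<And>j. j \<le> n \<Longrightarrow> n \<le> E j"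
    and "\<And>j l. j \<le> n \<Longrightarrow> l \<le> n \<Longrightarrow> c j l a = (if j = l then 1 else 0)"
  shows "\<exists>D s. I D s \<and> hompoly (S - {v}) D s \<and> s a = 1"
  using assms(3-)
proof (induction n arbitrary: c E)
  case 0
  then show ?case by (intro exI[of _ "E 0"] exI[of _ "c 0 0"]) auto
next
  case (Suc n)
  define k where "k = Suc n"
  \<comment> \<open>The last row is the pivot. Cross multiplication cancels the power
    \<open>x v ^ k\<close> and, by the values at \<open>a\<close>, leaves an identity matrix
    there.\<close>
  define c' where "c' = (\<lambda>j l x. c k k x * c j l x - c j k x * c k l x)"
  define E' where "E' = (\<lambda>j. (E k - k) + E j)"
  have hS: "hompoly S d f" if "hompoly (S - {v}) d f" for d f
    using that by (rule hompoly_mono) auto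
  show ?case
  proof (rule Suc.IH[of E' c'])
    fix j assume j: "j \<le> n"
    then have jk: "j \<le> Suc n" "k \<le> E j" "k \<le> E k" using Suc.prems(3) by (auto simp: k_def)
    have 1: "I (E' j) (\<lambda>x. c k k x * (\<Sum>l\<le>Suc n. c j l x * x v ^ l))"
      unfolding E'_def using jk Suc.prems(1,2) by (intro graded_idealD(4)[OF I] hS) (auto simp: k_def)
    have "I ((E j - k) + E k) (\<lambda>x. c j k x * (\<Sum>l\<le>Suc n. c k l x * x v ^ l))"
      using jk Suc.prems(1,2) by (intro graded_idealD(4)[OF I] hS) (auto simp: k_def)
    moreover have "(E j - k) + E k = E' j" using jk by (simp add: E'_def)
    ultimately have 2: "I (E' j) (\<lambda>x. c j k x * (\<Sum>l\<le>Suc n. c k l x * x v ^ l))" by simp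
    have "(\<Sum>l\<le>n. c' j l x * x v ^ l) =
       c k k x * (\<Sum>l\<le>Suc n. c j l x * x v ^ l) - c j k x * (\<Sum>l\<le>Suc n. c k l x * x v ^ l)" for x
      by (simp add: c'_def k_def sum_distrib_left sum_subtractf algebra_simps)
    then show "I (E' j) (\<lambda>x. \<Sum>l\<le>n. c' j l x * x v ^ l)"
      using graded_ideal_diff[OF I, OF 1 2] by simp
    show "n \<le> E' j" using jk by (simp add: E'_def k_def)
    fix l assume l: "l \<le> n"
    have e: "(E k - k) + (E j - l) = E' j - l" "(E j - k) + (E k - l) = E' j - l"
      using jk l unfolding E'_def by (auto simp: k_def)
    have "hompoly (S - {v}) ((E k - k) + (E j - l)) (\<lambda>x. c k k x * c j l x)"
      "hompoly (S - {v}) ((E j - k) + (E k - l)) (\<lambda>x. c j k x * c k l x)"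
      using jk l by (intro hompoly_mult Suc.prems(2); simp add: k_def)+
    then show "hompoly (S - {v}) (E' j - l) (c' j l)"
      unfolding e c'_def by (rule hompoly_diff)
    show "c' j l a = (if j = l then 1 else 0)"
      using j l Suc.prems(4) by (auto simp: c'_def k_def)
  qed
qed

text \<open>One more factor \<open>x v\<close> pushes the remainder to degree at most
  \<open>Suc n\<close> in \<open>x v\<close>, and a single subtraction of a multiple of
  \<open>F\<close> removes the top term. All degrees are tracked because quotient and coefficients
  must stay homogeneous.\<close>

lemma power_div_monic:
  fixes r :: "nat \<Rightarrow> ('n \<Rightarrow> 'a::comm_ring_1) \<Rightarrow> 'a"
  assumes r: "\<And>l. l \<le> n \<Longrightarrow> hompoly (S - {v}) (Suc n - l) (r l)" and v: "v \<in> S"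
    and F: "\<And>x. F x = x v ^ Suc n + (\<Sum>l\<le>n. r l x * x v ^ l)"
  shows "\<exists>q c. hompoly S j q \<and> (\<forall>l\<le>n. hompoly (S - {v}) (Suc n + j - l) (c l)) \<and>
           (\<forall>x. x v ^ (Suc n + j) = q x * F x + (\<Sum>l\<le>n. c l x * x v ^ l))"
proof (induction j)
  case 0
  show ?case
    by (rule exI[of _ "\<lambda>_. 1"], rule exI[of _ "\<lambda>l x. - r l x"])
      (use r in \<open>auto simp: F sum_negf intro: hompoly.const hompoly_uminus\<close>)
next
  case (Suc j)
  then obtain q c where q: "hompoly S j q" and c: "\<And>l. l \<le> n \<Longrightarrow> hompoly (S - {v}) (Suc n + j - l) (c l)"
    and eq: "\<And>x. x v ^ (Suc n + j) = q x * F x + (\<Sum>l\<le>n. c l x * x v ^ l)" by blast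
  define c' where "c' = (\<lambda>l x. (if l = 0 then 0 else c (l - 1) x) - c n x * r l x)"
  show ?case
  proof (intro exI[of _ "\<lambda>x. x v * q x + c n x"] exI[of _ c'] conjI allI impI)
    have "hompoly (S - {v}) (Suc j) (c n)" using c[of n] by simp
    then have "hompoly S (Suc j) (c n)" by (rule hompoly_mono) auto
    then show "hompoly S (Suc j) (\<lambda>x. x v * q x + c n x)" using q v by (intro hompoly.intros) auto
  next
    fix l assume l: "l \<le> n"
    have "hompoly (S - {v}) (Suc j + (Suc n - l)) (\<lambda>x. c n x * r l x)"
      using c[of n] r[OF l] by (intro hompoly_mult) auto
    moreover have "Suc j + (Suc n - l) = Suc n + Suc j - l" using l by simp
    ultimately have 1: "hompoly (S - {v}) (Suc n + Suc j - l) (\<lambda>x. c n x * r l x)" by metis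
    have 2: "hompoly (S - {v}) (Suc n + Suc j - l) (\<lambda>x. if l = 0 then 0 else c (l - 1) x)"
    proof (cases l)
      case 0 then show ?thesis by (simp add: hompoly.zero)
    next
      case (Suc l') then show ?thesis using c[of l'] l by simp
    qed
    show "hompoly (S - {v}) (Suc n + Suc j - l) (c' l)"
      unfolding c'_def by (rule hompoly_diff[OF 2 1])
  next
    fix x
    have shift: "(\<Sum>l\<le>n. c l x * x v ^ Suc l) = c n x * x v ^ Suc n + (\<Sum>l\<le>n. (if l = 0 then 0 else c (l - 1) x) * x v ^ l)"
    proof (cases n)
      case (Suc n')
      have "(\<Sum>l\<le>Suc n'. (if l = 0 then 0 else c (l - 1) x) * x v ^ l) = (\<Sum>l\<le>n'. c l x * x v ^ Suc l)"
        by (subst sum.atMost_Suc_shift) simp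
      then show ?thesis unfolding Suc by simp
    qed simp
    have "x v ^ (Suc n + Suc j) = x v * x v ^ (Suc n + j)" by simp
    also have "\<dots> = x v * q x * F x + (\<Sum>l\<le>n. c l x * x v ^ Suc l)"
      unfolding eq by (simp add: sum_distrib_left algebra_simps)
    also have "\<dots> = x v * q x * F x + c n x * (F x - (\<Sum>l\<le>n. r l x * x v ^ l)) +
        (\<Sum>l\<le>n. (if l = 0 then 0 else c (l - 1) x) * x v ^ l)"
      unfolding shift F by simp
    also have "\<dots> = (x v * q x + c n x) * F x + (\<Sum>l\<le>n. c' l x * x v ^ l)"
      unfolding c'_def by (simp add: left_diff_distrib right_diff_distrib sum_subtractf sum_distrib_left distrib_right mult.assoc)
    finally show "x v ^ (Suc n + Suc j) = (x v * q x + c n x) * F x + (\<Sum>l\<le>n. c' l x * x v ^ l)" .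
  qed
qed

text \<open>The claim is additive in \<open>f\<close>, so expanding in powers of \<open>x v\<close>
  leaves a coefficient times one power: low powers are their own remainder, high ones come from
  \<open>power_div_monic\<close>.\<close>

lemma hompoly_div_monic:
  fixes r :: "nat \<Rightarrow> ('n \<Rightarrow> 'a::comm_ring_1) \<Rightarrow> 'a"
  assumes r: "\<And>l. l \<le> n \<Longrightarrow> hompoly (S - {v}) (Suc n - l) (r l)" and v: "v \<in> S"
    and F: "\<And>x. F x = x v ^ Suc n + (\<Sum>l\<le>n. r l x * x v ^ l)"
    and f: "hompoly S (Suc n + e) f"
  shows "\<exists>q c. hompoly S e q \<and> (\<forall>l\<le>n. hompoly (S - {v}) (Suc n + e - l) (c l)) \<and>
           (\<forall>x. f x = q x * F x + (\<Sum>l\<le>n. c l x * x v ^ l))"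
proof -
  define P where "P = (\<lambda>f. \<exists>q c. hompoly S e q \<and> (\<forall>l\<le>n. hompoly (S - {v}) (Suc n + e - l) (c l)) \<and>
           (\<forall>x. f x = q x * F x + (\<Sum>l\<le>n. c l x * x v ^ l)))"
  have P0: "P (\<lambda>_. 0)" unfolding P_def
    by (rule exI[of _ "\<lambda>_. 0"], rule exI[of _ "\<lambda>_ _. 0"]) (auto intro: hompoly.zero)
  have Padd: "P (\<lambda>x. g x + h x)" if "P g" "P h" for g h
  proof -
    obtain q c q' c' where "hompoly S e q" "\<And>l. l \<le> n \<Longrightarrow> hompoly (S - {v}) (Suc n + e - l) (c l)"
      "\<And>x. g x = q x * F x + (\<Sum>l\<le>n. c l x * x v ^ l)"
      "hompoly S e q'" "\<And>l. l \<le> n \<Longrightarrow> hompoly (S - {v}) (Suc n + e - l) (c' l)"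
      "\<And>x. h x = q' x * F x + (\<Sum>l\<le>n. c' l x * x v ^ l)"
      using \<open>P g\<close> \<open>P h\<close> unfolding P_def by blast
    then show ?thesis unfolding P_def
      by (intro exI[of _ "\<lambda>x. q x + q' x"] exI[of _ "\<lambda>l x. c l x + c' l x"])
        (auto simp: distrib_right sum.distrib add_ac intro: hompoly.add)
  qed
  have Psum: "P (\<lambda>x. \<Sum>i\<in>A. g i x)" if "finite A" "\<And>i. i \<in> A \<Longrightarrow> P (g i)" for A :: "nat set" and g
    using that by (induction A rule: finite_induct) (auto intro: P0 Padd)
  obtain \<rho> where \<rho>: "\<And>k. k \<le> Suc n + e \<Longrightarrow> hompoly (S - {v}) (Suc n + e - k) (\<rho> k)"
    "\<And>x. f x = (\<Sum>k\<le>Suc n + e. \<rho> k x * x v ^ k)"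
    using hompoly_expand[OF f v] by blast
  have "P (\<lambda>x. \<rho> k x * x v ^ k)" if k: "k \<le> Suc n + e" for k
  proof (cases "k \<le> n")
    case True
    have *: "(\<Sum>l\<le>n. (if l = k then \<rho> k else (\<lambda>_. 0)) x * x v ^ l) = \<rho> k x * x v ^ k" for x
      using True by (subst sum.remove[of _ k]) (auto intro!: sum.neutral)
    show ?thesis unfolding P_def
      by (rule exI[of _ "\<lambda>_. 0"], rule exI[of _ "\<lambda>l. if l = k then \<rho> k else (\<lambda>_. 0)"])
        (use \<rho>(1)[OF k] in \<open>auto simp: * hompoly.zero\<close>)
  next
    case False
    define j where "j = k - Suc n"
    have kj: "k = Suc n + j" "j \<le> e" using False k by (auto simp: j_def)
    obtain q c where q: "hompoly S j q" and c: "\<And>l. l \<le> n \<Longrightarrow> hompoly (S - {v}) (Suc n + j - l) (c l)"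
      and eq: "\<And>x. x v ^ (Suc n + j) = q x * F x + (\<Sum>l\<le>n. c l x * x v ^ l)"
      using power_div_monic[where j = j, OF r v F] by blast
    have \<rho>k: "hompoly (S - {v}) (e - j) (\<rho> k)" using \<rho>(1)[OF k] kj by simp
    then have \<rho>S: "hompoly S (e - j) (\<rho> k)" by (rule hompoly_mono) auto
    show ?thesis unfolding P_def
    proof (intro exI[of _ "\<lambda>x. \<rho> k x * q x"] exI[of _ "\<lambda>l x. \<rho> k x * c l x"] conjI allI impI)
      show "hompoly S e (\<lambda>x. \<rho> k x * q x)" using hompoly_mult[OF \<rho>S q] kj by simp
      show "hompoly (S - {v}) (Suc n + e - l) (\<lambda>x. \<rho> k x * c l x)" if "l \<le> n" for l
      proof -
        have "(e - j) + (Suc n + j - l) = Suc n + e - l" using that kj by simp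
        then show ?thesis using hompoly_mult[OF \<rho>k c[OF that]] by simp
      qed
      show "\<rho> k x * x v ^ k = \<rho> k x * q x * F x + (\<Sum>l\<le>n. \<rho> k x * c l x * x v ^ l)" for x
        unfolding kj(1) eq by (simp add: distrib_left sum_distrib_left mult.assoc)
    qed
  qed
  then have "P (\<lambda>x. \<Sum>k\<le>Suc n + e. \<rho> k x * x v ^ k)" by (intro Psum) auto
  then have "P f" using \<rho>(2) by presburger
  then show ?thesis unfolding P_def .
qed

text \<open>A nonzero element of least degree divides all others; a root of it would be a common
  zero, so over an algebraically closed field it is constant.\<close>

lemma poly_ideal_const:
  fixes \<I> :: "'a::alg_closed_field poly set"
  assumes add: "\<And>p q. p \<in> \<I> \<Longrightarrow> q \<in> \<I> \<Longrightarrow> p + q \<in> \<I>" and mult: "\<And>p q. p \<in> \<I> \<Longrightarrow> q * p \<in> \<I>"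
    and nz: "p0 \<in> \<I>" "p0 \<noteq> 0" and no_root: "\<And>t. \<exists>p\<in>\<I>. poly p t \<noteq> 0"
  shows "1 \<in> \<I>"
proof -
  obtain g where g: "g \<in> \<I>" "g \<noteq> 0" and min: "\<And>h. h \<in> \<I> \<Longrightarrow> h \<noteq> 0 \<Longrightarrow> Polynomial.degree g \<le> Polynomial.degree h"
    using ex_has_least_nat[of "\<lambda>p. p \<in> \<I> \<and> p \<noteq> 0" p0 Polynomial.degree] nz by blast
  have dvd: "g dvd p" if "p \<in> \<I>" for p
  proof -
    have "p mod g = p + (- (p div g)) * g" by (simp add: minus_div_mult_eq_mod[symmetric])
    then have "p mod g \<in> \<I>" using add[OF that mult[OF g(1)]] by metis
    then show ?thesis using min degree_mod_less[OF g(2), of p] by (meson leD mod_eq_0_iff_dvd)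
  qed
  have "Polynomial.degree g = 0"
  proof (rule ccontr)
    assume "Polynomial.degree g \<noteq> 0"
    then obtain t where "poly g t = 0" using alg_closed_imp_poly_has_root by blast
    moreover obtain p where "p \<in> \<I>" "poly p t \<noteq> 0" using no_root by blast
    ultimately show False using dvd[of p] by (auto simp: dvd_def)
  qed
  then obtain c where c: "g = [:c:]" by (rule degree_eq_zeroE)
  then have "[:1 / c:] * g = 1" using g(2) by (simp add: one_pCons)
  then show ?thesis using mult[OF g(1)] by metis
qed

text \<open>Restriction to the line through \<open>a\<close> in direction \<open>v\<close>. The
  factor \<open>(x i / a i) ^ e\<close> equals 1 on this line and raises the degree, so elements of
  different degrees can be added and the degree made as large as desired.\<close>

lemma hompoly_restrict_ideal:
  fixes I :: "nat \<Rightarrow> (('n \<Rightarrow> 'a::field) \<Rightarrow> 'a) \<Rightarrow> bool"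
  assumes I: "graded_ideal S I" and v: "v \<in> S" and i: "i \<in> S" "i \<noteq> v" "a i \<noteq> 0"
  defines "\<I> \<equiv> {p. \<exists>D f. I D f \<and> (\<forall>t. f (a(v := t)) = poly p t)}"
  shows "p \<in> \<I> \<Longrightarrow> q \<in> \<I> \<Longrightarrow> p + q \<in> \<I>" "p \<in> \<I> \<Longrightarrow> q * p \<in> \<I>"
    "p \<in> \<I> \<Longrightarrow> \<exists>D f. D \<ge> k \<and> I D f \<and> (\<forall>t. f (a(v := t)) = poly p t)"
proof -
  have lift: "\<exists>f'. I (e + D) f' \<and> (\<forall>t. f' (a(v := t)) = f (a(v := t)))" if "I D f" for D f e
  proof (intro exI[of _ "\<lambda>x. (inverse (a i) ^ e * x i ^ e) * f x"] conjI allI)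
    show "I (e + D) (\<lambda>x. (inverse (a i) ^ e * x i ^ e) * f x)"
      using that i by (intro graded_idealD(4)[OF I] hompoly_scale hompoly_power)
    show "inverse (a i) ^ e * (a(v := t)) i ^ e * f (a(v := t)) = f (a(v := t))" for t
      using i by (simp flip: power_mult_distrib)
  qed
  have add: "p + q \<in> \<I>" if pq: "p \<in> \<I>" "q \<in> \<I>" for p q
  proof -
    obtain D f D' f' where f: "I D f" "\<And>t. f (a(v := t)) = poly p t" "I D' f'" "\<And>t. f' (a(v := t)) = poly q t"
      using pq unfolding \<I>_def by blast
    obtain g g' where "I (D' + D) g" "\<And>t. g (a(v := t)) = f (a(v := t))"
      "I (D + D') g'" "\<And>t. g' (a(v := t)) = f' (a(v := t))"
      using lift[OF f(1)] lift[OF f(3)] by metis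
    then show ?thesis using f graded_idealD(3)[OF I, of "D + D'" g g']
      unfolding \<I>_def by (auto simp: add.commute intro!: exI[of _ "D + D'"] exI[of _ "\<lambda>x. g x + g' x"])
  qed
  then show "p \<in> \<I> \<Longrightarrow> q \<in> \<I> \<Longrightarrow> p + q \<in> \<I>" .
  have smult: "Polynomial.smult c p \<in> \<I>" if p: "p \<in> \<I>" for c p
  proof -
    obtain D f where f: "I D f" "\<And>t. f (a(v := t)) = poly p t" using p unfolding \<I>_def by blast
    then show ?thesis using graded_ideal_scale[OF I, of D f c] unfolding \<I>_def
      by (intro CollectI exI[of _ D] exI[of _ "\<lambda>x. c * f x"]) auto
  qed
  have shift: "pCons 0 p \<in> \<I>" if p: "p \<in> \<I>" for p
  proof -
    obtain D f where f: "I D f" "\<And>t. f (a(v := t)) = poly p t" using p unfolding \<I>_def by blast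
    have "I (1 + D) (\<lambda>x. x v ^ 1 * f x)" using v f by (intro graded_idealD(4)[OF I] hompoly_power)
    then show ?thesis using f unfolding \<I>_def
      by (intro CollectI exI[of _ "1 + D"] exI[of _ "\<lambda>x. x v ^ 1 * f x"]) auto
  qed
  show "q * p \<in> \<I>" if "p \<in> \<I>"
  proof (induction q)
    case 0
    then show ?case using smult[OF that, of 0] by simp
  next
    case (pCons c q)
    then show ?case using add[OF smult[OF that] shift] by (simp add: mult_pCons_left)
  qed
  show "\<exists>D f. D \<ge> k \<and> I D f \<and> (\<forall>t. f (a(v := t)) = poly p t)" if p: "p \<in> \<I>"
  proof -
    obtain D f where f: "I D f" "\<And>t. f (a(v := t)) = poly p t" using p unfolding \<I>_def by blast
    then obtain f' where "I (k + D) f'" "\<And>t. f' (a(v := t)) = f (a(v := t))" using lift[OF f(1)] by blast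
    then show ?thesis using f by (intro exI[of _ "k + D"] exI[of _ f']) auto
  qed
qed

text \<open>Elimination of \<open>v\<close>, pointwise at \<open>a\<close>. Unless it contains a
  nonzero constant already, the ideal contains a form \<open>F\<close> monic in \<open>x v\<close>,
  and a form \<open>h\<close> that is constantly 1 on the line through \<open>a\<close> in direction
  \<open>v\<close>. Dividing \<open>x v ^ j * h\<close> by \<open>F\<close> for
  \<open>j \<le> n\<close> gives rows of remainder coefficients that form the identity matrix at
  \<open>a\<close>, and \<open>graded_ideal_eliminate\<close> turns them into a form free of
  \<open>v\<close> with value 1 at \<open>a\<close>.\<close>

lemma graded_ideal_extension:
  fixes I :: "nat \<Rightarrow> (('n \<Rightarrow> 'a::{alg_closed_field,field_char_0}) \<Rightarrow> 'a) \<Rightarrow> bool"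
  assumes I: "graded_ideal S I" and v: "v \<in> S" and i: "i \<in> S" "i \<noteq> v" "a i \<noteq> 0"
    and nozero: "\<And>x. \<exists>j\<in>S. x j \<noteq> 0 \<Longrightarrow> \<exists>d f. I d f \<and> f x \<noteq> 0"
  shows "\<exists>d f. I d f \<and> hompoly (S - {v}) d f \<and> f a \<noteq> 0"
proof -
  \<comment> \<open>At the coordinate point of \<open>v\<close> only the pure power of
    \<open>x v\<close> survives, so \<open>F0 e \<noteq> 0\<close> makes its coefficient a nonzero
    constant.\<close>
  define e where "e = (\<lambda>j. if j = v then 1 else (0::'a))"
  have "\<exists>j\<in>S. e j \<noteq> 0" using v by (auto simp: e_def)
  then obtain d F0 where F0: "I d F0" "F0 e \<noteq> 0" using nozero by blast
  obtain r0 where r0: "\<And>l. l \<le> d \<Longrightarrow> hompoly (S - {v}) (d - l) (r0 l)"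
    "\<And>x. F0 x = (\<Sum>l\<le>d. r0 l x * x v ^ l)"
    using hompoly_expand[OF graded_idealD(1)[OF I, OF F0(1)] v] by blast
  show ?thesis
  proof (cases d)
    case 0
    have "F0 = r0 0" using r0(2) 0 by (simp add: fun_eq_iff)
    then have "hompoly (S - {v}) 0 F0" using r0(1)[of 0] 0 by simp
    moreover have "F0 a = F0 e" using hompoly_0_const[OF calculation] .
    ultimately show ?thesis using F0 0 by (intro exI[of _ 0] exI[of _ F0]) simp
  next
    case (Suc n)
    define b where "b = r0 d e"
    have r0d: "r0 d x = b" for x unfolding b_def using hompoly_0_const[of "S - {v}" "r0 d"] r0(1)[of d] by simp
    have "F0 e = b"
    proof -
      have "r0 l e = 0" if "l < d" for l
        using hompoly_vanish[OF r0(1)[of l]] that by (auto simp: e_def)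
      then have "F0 e = r0 d e * e v ^ d"
        unfolding r0(2) by (subst sum.remove[of _ d]) (auto intro!: sum.neutral)
      then show ?thesis by (simp add: b_def e_def)
    qed
    then have b: "b \<noteq> 0" using F0 by simp
    define r where "r = (\<lambda>l x. inverse b * r0 l x)"
    have r: "hompoly (S - {v}) (Suc n - l) (r l)" if "l \<le> n" for l
      unfolding r_def using r0(1)[of l] that Suc by (intro hompoly_scale) auto
    define F where "F = (\<lambda>x. inverse b * F0 x)"
    have IF: "I (Suc n) F" unfolding F_def using graded_ideal_scale[OF I, OF F0(1)] Suc by simp
    have F: "F x = x v ^ Suc n + (\<Sum>l\<le>n. r l x * x v ^ l)" for x
      unfolding F_def r0(2) r_def using b r0d by (simp add: Suc sum_distrib_left algebra_simps)
    have ra: "r l (a(v := t)) = r l a" if "l \<le> n" for l t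
      by (rule hompoly_cong[OF r[OF that]]) auto
    define Fa where "Fa = Polynomial.monom 1 (Suc n) + (\<Sum>l\<le>n. Polynomial.monom (r l a) l)"
    have Fa: "F (a(v := t)) = poly Fa t" for t
      unfolding F Fa_def using ra by (simp add: poly_monom poly_sum)
    have deg: "Polynomial.degree (\<Sum>l\<le>n. Polynomial.monom (c l) l) \<le> n" for c :: "nat \<Rightarrow> 'a"
      by (rule degree_sum_le) (auto intro: order_trans[OF degree_monom_le])
    have coeff_sum: "Polynomial.coeff (\<Sum>l\<le>n. Polynomial.monom (c l) l) k = (if k \<le> n then c k else 0)" for c :: "nat \<Rightarrow> 'a" and k
      by (simp add: coeff_sum)
    have degF: "Polynomial.degree Fa = Suc n"
      unfolding Fa_def using deg[of "\<lambda>l. r l a"] by (subst degree_add_eq_left) (auto simp: degree_monom_eq)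
    define \<I> where "\<I> = {p. \<exists>D f. I D f \<and> (\<forall>t. f (a(v := t)) = poly p t)}"
    note restr = hompoly_restrict_ideal[where a = a, OF I v i, folded \<I>_def]
    have "Fa \<in> \<I>" "Fa \<noteq> 0" using IF Fa degF unfolding \<I>_def by auto
    moreover have "\<exists>p\<in>\<I>. poly p t \<noteq> 0" for t
    proof -
      have "\<exists>j\<in>S. (a(v := t)) j \<noteq> 0" using i by auto
      then obtain D f where f: "I D f" "f (a(v := t)) \<noteq> 0" using nozero by blast
      obtain p where "\<forall>t. f (a(v := t)) = poly p t"
        using hompoly_restrict_poly[OF graded_idealD(1)[OF I, OF f(1)]] by blast
      then show ?thesis using f unfolding \<I>_def by auto
    qed
    ultimately have "1 \<in> \<I>" using restr(1,2) poly_ideal_const by metis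
    then obtain D h where h: "D \<ge> Suc n" "I D h" "\<And>t. h (a(v := t)) = 1"
      using restr(3)[of 1 "Suc n"] by auto
    define k where "k = D - Suc n"
    have D: "D = Suc n + k" using h by (simp add: k_def)
    define P where "P = (\<lambda>j q c. hompoly S (k + j) q \<and> (\<forall>l\<le>n. hompoly (S - {v}) (Suc n + (k + j) - l) (c l)) \<and>
           (\<forall>x. x v ^ j * h x = q x * F x + (\<Sum>l\<le>n. c l x * x v ^ l)))"
    have row: "\<exists>q c. P j q c" for j
      unfolding P_def
    proof (rule hompoly_div_monic[OF r v F])
      have "hompoly S (j + D) (\<lambda>x. x v ^ j * h x)"
        using v graded_idealD(1)[OF I, OF h(2)] by (intro hompoly_mult hompoly_power)
      then show "hompoly S (Suc n + (k + j)) (\<lambda>x. x v ^ j * h x)" by (simp add: D add_ac)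
    qed
    then obtain q c where qc: "\<And>j. P j (q j) (c j)" by metis
    have q: "hompoly S (k + j) (q j)"
      and c: "l \<le> n \<Longrightarrow> hompoly (S - {v}) (Suc n + (k + j) - l) (c j l)"
      and eq: "x v ^ j * h x = q j x * F x + (\<Sum>l\<le>n. c j l x * x v ^ l)" for j l x
      using qc[of j] unfolding P_def by blast+
    have "\<exists>D s. I D s \<and> hompoly (S - {v}) D s \<and> s a = 1"
    proof (rule graded_ideal_eliminate[OF I v, where E = "\<lambda>j. Suc n + (k + j)" and c = c and n = n])
      fix j assume j: "j \<le> n"
      have 1: "I (Suc n + (k + j)) (\<lambda>x. x v ^ j * h x)"
        using graded_idealD(4)[OF I, OF hompoly_power[OF v, of j] h(2)] by (simp add: D add_ac)
      have 2: "I (Suc n + (k + j)) (\<lambda>x. q j x * F x)"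
        using graded_idealD(4)[OF I, OF q IF] by (simp add: add_ac)
      have "(\<Sum>l\<le>n. c j l x * x v ^ l) = x v ^ j * h x - q j x * F x" for x using eq by simp
      then show "I (Suc n + (k + j)) (\<lambda>x. \<Sum>l\<le>n. c j l x * x v ^ l)"
        using graded_ideal_diff[OF I, OF 1 2] by simp
      show "n \<le> Suc n + (k + j)" by simp
      fix l assume l: "l \<le> n"
      show "hompoly (S - {v}) (Suc n + (k + j) - l) (c j l)" by (rule c[OF l])
      have ca: "c j l (a(v := t)) = c j l a" if "l \<le> n" for l t
        by (rule hompoly_cong[OF c[OF that]]) auto
      obtain Q where Q: "\<And>t. q j (a(v := t)) = poly Q t" using hompoly_restrict_poly[OF q] by blast
      \<comment> \<open>On the line the remainder must be \<open>t ^ j\<close>: the difference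
        \<open>R\<close> has degree at most \<open>n\<close>, yet it is a multiple of
        \<open>Fa\<close>, which has degree \<open>Suc n\<close>.\<close>
      define R where "R = (\<Sum>l\<le>n. Polynomial.monom ((if l = j then 1 else 0) - c j l a) l)"
      have "poly R t = poly (Q * Fa) t" for t
      proof -
        have "poly R t = t ^ j - (\<Sum>l\<le>n. c j l a * t ^ l)"
          unfolding R_def using j
          by (simp add: poly_sum poly_monom left_diff_distrib sum_subtractf if_distrib[of "\<lambda>y. y * _"] cong: if_cong)
        also have "\<dots> = poly (Q * Fa) t"
          using eq[of "a(v := t)" j] h(3) Q Fa ca by simp
        finally show ?thesis .
      qed
      then have RQ: "R = Q * Fa" by (simp add: poly_eq_poly_eq_iff[symmetric] fun_eq_iff)
      have "R = 0"
      proof (rule ccontr)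
        assume "R \<noteq> 0"
        then have "Polynomial.degree R = Polynomial.degree Q + Suc n" using RQ degF by (auto simp: degree_mult_eq)
        moreover have "Polynomial.degree R \<le> n" unfolding R_def by (rule deg)
        ultimately show False by simp
      qed
      then have "Polynomial.coeff R l = 0" by simp
      then show "c j l a = (if j = l then 1 else 0)"
        using l unfolding R_def coeff_sum by (auto split: if_splits)
    qed
    then show ?thesis by (metis zero_neq_one)
  qed
qed

text \<open>Induction on the number of variables: by \<open>graded_ideal_extension\<close> the forms
  of the ideal that are free of \<open>v\<close> again have no common zero off the origin. When only
  \<open>i\<close> is left, a form is a constant times a power of \<open>x i\<close>.\<close>

theorem graded_nullstellensatz:
  fixes I :: "nat \<Rightarrow> (('n \<Rightarrow> 'a::{alg_closed_field,field_char_0}) \<Rightarrow> 'a) \<Rightarrow> bool"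
  assumes "finite S" "graded_ideal S I" "\<And>x. \<exists>j\<in>S. x j \<noteq> 0 \<Longrightarrow> \<exists>d f. I d f \<and> f x \<noteq> 0" "i \<in> S"
  shows "\<exists>e. I e (\<lambda>x. x i ^ e)"
  using assms
proof (induction "card S" arbitrary: S I rule: less_induct)
  case less
  note I = less.prems(2)
  show ?case
  proof (cases "S = {i}")
    case True
    obtain d f where f: "I d f" "f (\<lambda>_. 1) \<noteq> 0" using less.prems(3)[of "\<lambda>_. 1"] less.prems(4) by auto
    have fx: "f x = x i ^ d * f (\<lambda>_. 1)" for x
    proof -
      have "f x = f (\<lambda>j. x i * 1)"
        by (rule hompoly_cong[OF graded_idealD(1)[OF I, OF f(1)]]) (auto simp: True)
      also have "\<dots> = x i ^ d * f (\<lambda>_. 1)"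
        by (rule hompoly_homogeneous[OF graded_idealD(1)[OF I, OF f(1)]])
      finally show ?thesis .
    qed
    have "I d (\<lambda>x. inverse (f (\<lambda>_. 1)) * f x)" by (rule graded_ideal_scale[OF I, OF f(1)])
    moreover have "inverse (f (\<lambda>_. 1)) * f x = x i ^ d" for x using f(2) fx[of x] by simp
    ultimately show ?thesis by auto
  next
    case False
    then obtain v where v: "v \<in> S" "v \<noteq> i" using less.prems(4) by blast
    define J where "J = (\<lambda>d f. I d f \<and> hompoly (S - {v}) d f)"
    have "\<exists>e. J e (\<lambda>x. x i ^ e)"
    proof (rule less.hyps)
      show "card (S - {v}) < card S" by (rule card_Diff1_less[OF less.prems(1) v(1)])
      have hS: "hompoly S d f" if "hompoly (S - {v}) d f" for d f
        using that by (rule hompoly_mono) auto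
      show "graded_ideal (S - {v}) J"
        unfolding graded_ideal_def J_def
        by (auto intro: graded_idealD[OF I] hS hompoly.intros hompoly_mult)
      show "\<exists>d f. J d f \<and> f x \<noteq> 0" if "\<exists>j\<in>S - {v}. x j \<noteq> 0" for x
        using that graded_ideal_extension[OF I v(1), of _ x, OF _ _ _ less.prems(3)] unfolding J_def by blast
    qed (use less.prems v in auto)
    then show ?thesis unfolding J_def by blast
  qed
qed

section \<open>Lifts of preperiodic points\<close>

text \<open>A polynomial equation for \<open>x\<close> over the number field, with denominators
  cleared by scaling \<open>x\<close>, is a one-variable instance of
  \<open>bounded_int_of_relations\<close>.\<close>

lemma alg_closure_bounded_multiple:
  fixes x :: "'k::field_char_0 alg_closure"
  assumes "number_field TYPE('k)"
  shows "\<exists>D r. D > 0 \<and> bounded_int r (of_int D * x)"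
proof -
  obtain p :: "'k poly" where p: "p \<noteq> 0" "poly (map_poly to_ac p) x = 0"
    by (rule alg_closure_algebraic)
  define s where "s = Polynomial.degree p"
  define \<kappa> where "\<kappa> = (\<lambda>l. - (Polynomial.coeff p l / Polynomial.lead_coeff p))"
  have lc: "Polynomial.lead_coeff p \<noteq> 0" using p by simp
  have deg: "Polynomial.degree (map_poly to_ac p) = s" unfolding s_def by (rule degree_map_poly) auto
  have "(\<Sum>l\<le>s. to_ac (Polynomial.coeff p l) * x ^ l) = 0"
    using p(2) unfolding poly_altdef deg by (simp add: coeff_map_poly)
  then have "to_ac (Polynomial.lead_coeff p) * x ^ s + (\<Sum>l<s. to_ac (Polynomial.coeff p l) * x ^ l) = 0"
    by (simp add: lessThan_Suc_atMost[symmetric] s_def add.commute)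
  then have "to_ac (Polynomial.lead_coeff p) * x ^ s = - (\<Sum>l<s. to_ac (Polynomial.coeff p l) * x ^ l)"
    by (simp add: add_eq_0_iff2)
  then have "x ^ s = - (\<Sum>l<s. to_ac (Polynomial.coeff p l) * x ^ l) / to_ac (Polynomial.lead_coeff p)"
    using lc by (simp add: field_simps)
  then have xs: "x ^ s = (\<Sum>l<s. to_ac (\<kappa> l) * x ^ l)"
    by (simp add: \<kappa>_def sum_negf sum_divide_distrib)
  obtain D r where D: "D > 0" "r \<ge> 1" "\<And>l. l < s \<Longrightarrow> bounded_int r (of_int D * \<kappa> l)"
    using common_bounded_multiple[of "\<kappa> ` {..<s}"] number_field_bounded_multiple[OF assms] by auto
  define z where "z = of_int D * x"
  \<comment> \<open>Scaling \<open>x\<close> by \<open>D\<close> multiplies the coefficient at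
    \<open>l\<close> by \<open>D ^ (s - l)\<close>; one factor makes \<open>\<kappa> l\<close>
    bounded, the others form an integer multiplier.\<close>
  define c where "c = (\<lambda>l. of_int (D ^ (s - Suc l)) * to_ac (of_int D * \<kappa> l))"
  define g where "g = real_of_int D ^ s * r"
  have "bounded_int (max 1 (real s * g)) z"
  proof (rule bounded_int_of_relations[where J = "{()}" and T = "{..<s}" and z = "\<lambda>_. z" and c = "\<lambda>_. c"
        and e = "\<lambda>_. s" and E = "\<lambda>_ l _. l" and g = g and j = "()", simplified])
    fix l assume l: "l < s"
    have "bounded_int (\<bar>real_of_int (D ^ (s - Suc l))\<bar> * r) (c l)"
      unfolding c_def by (intro bounded_int_scale bounded_int_to_ac D l)
    then show "bounded_int g (c l)"
      by (rule bounded_int_mono) (use D in \<open>auto simp: g_def power_abs intro!: mult_right_mono power_increasing\<close>)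
  next
    have "z ^ s = of_int D ^ s * (\<Sum>l<s. to_ac (\<kappa> l) * x ^ l)"
      by (simp add: z_def power_mult_distrib xs)
    also have "\<dots> = (\<Sum>l<s. c l * z ^ l)"
      unfolding sum_distrib_left
    proof (rule sum.cong[OF refl])
      fix l assume "l \<in> {..<s}"
      then have "s = (s - Suc l) + 1 + l" by simp
      then have "(of_int D :: 'k alg_closure) ^ s = of_int D ^ (s - Suc l) * of_int D * of_int D ^ l"
        by (metis power_add power_one_right)
      then show "of_int D ^ s * (to_ac (\<kappa> l) * x ^ l) = c l * z ^ l"
        by (simp add: c_def z_def power_mult_distrib)
    qed
    finally show "z ^ s = (\<Sum>l<s. c l * z ^ l)" .
  qed auto
  then show ?thesis using D(1) unfolding z_def by blast
qed

lemma forms_nullstellensatz: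
  fixes f :: "'n::finite \<Rightarrow> ('n \<Rightarrow> 'a::{alg_closed_field,field_char_0}) \<Rightarrow> 'a"
  assumes f: "\<And>j. hompoly UNIV d (f j)"
    and nozero: "\<And>x. \<exists>j. x j \<noteq> 0 \<Longrightarrow> \<exists>j. f j x \<noteq> 0"
  shows "\<exists>e G. d \<le> e \<and> (\<forall>i j. hompoly UNIV (e - d) (G i j)) \<and> (\<forall>i x. x i ^ e = (\<Sum>j\<in>UNIV. G i j x * f j x))"
proof -
  \<comment> \<open>Below degree \<open>d\<close> the difference \<open>e - d\<close> would be
    truncated to 0 and admit constant cofactors, so there the cofactors are forced to
    vanish.\<close>
  define I where "I = (\<lambda>e h. \<exists>G. (\<forall>x. h x = (\<Sum>j\<in>UNIV. G j x * f j x)) \<and>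
      (\<forall>j. if d \<le> e then hompoly UNIV (e - d) (G j) else G j = (\<lambda>_. 0)))"
  have I: "graded_ideal UNIV I"
    unfolding graded_ideal_def
  proof (intro conjI allI impI)
    fix e h assume "I e h"
    then obtain G where G: "\<And>x. h x = (\<Sum>j\<in>UNIV. G j x * f j x)"
      "\<And>j. if d \<le> e then hompoly UNIV (e - d) (G j) else G j = (\<lambda>_. 0)" unfolding I_def by blast
    have "hompoly UNIV e (\<lambda>x. \<Sum>j\<in>UNIV. G j x * f j x)"
    proof (rule hompoly_sum)
      fix j
      show "hompoly UNIV e (\<lambda>x. G j x * f j x)"
      proof (cases "d \<le> e")
        case True
        then show ?thesis using hompoly_mult[OF _ f, of "e - d" "G j" j] G(2)[of j] by simp
      next
        case False
        then show ?thesis using G(2)[of j] by (simp add: hompoly.zero)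
      qed
    qed simp
    moreover have "h = (\<lambda>x. \<Sum>j\<in>UNIV. G j x * f j x)" using G(1) by blast
    ultimately show "hompoly UNIV e h" by simp
  next
    fix e show "I e (\<lambda>_. 0)" unfolding I_def
      by (rule exI[of _ "\<lambda>_ _. 0"]) (auto intro: hompoly.zero)
  next
    fix e h k assume "I e h" "I e k"
    then obtain G H where G: "\<And>x. h x = (\<Sum>j\<in>UNIV. G j x * f j x)"
      "\<And>j. if d \<le> e then hompoly UNIV (e - d) (G j) else G j = (\<lambda>_. 0)"
      and H: "\<And>x. k x = (\<Sum>j\<in>UNIV. H j x * f j x)"
      "\<And>j. if d \<le> e then hompoly UNIV (e - d) (H j) else H j = (\<lambda>_. 0)" unfolding I_def by blast
    show "I e (\<lambda>x. h x + k x)" unfolding I_def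
      by (rule exI[of _ "\<lambda>j x. G j x + H j x"])
        (use G H in \<open>auto simp: distrib_right sum.distrib intro: hompoly.add split: if_splits\<close>)
  next
    fix d' e h and g :: "('n \<Rightarrow> 'a) \<Rightarrow> 'a" assume g: "hompoly UNIV e g" and "I d' h"
    then obtain G where G: "\<And>x. h x = (\<Sum>j\<in>UNIV. G j x * f j x)"
      "\<And>j. if d \<le> d' then hompoly UNIV (d' - d) (G j) else G j = (\<lambda>_. 0)" unfolding I_def by blast
    show "I (e + d') (\<lambda>x. g x * h x)" unfolding I_def
    proof (intro exI[of _ "\<lambda>j x. g x * G j x"] conjI allI)
      show "g x * h x = (\<Sum>j\<in>UNIV. g x * G j x * f j x)" for x :: "'n \<Rightarrow> 'a"
        by (simp add: G(1) sum_distrib_left mult.assoc)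
      show "if d \<le> e + d' then hompoly UNIV (e + d' - d) (\<lambda>x. g x * G j x) else (\<lambda>x. g x * G j x) = (\<lambda>_. 0)" for j
      proof (cases "d \<le> d'")
        case True
        then show ?thesis using hompoly_mult[OF g, of "d' - d" "G j"] G(2)[of j] by simp
      next
        case False
        then show ?thesis using G(2)[of j] by (simp add: hompoly.zero)
      qed
    qed
  qed
  have If: "I d (f j)" for j
    unfolding I_def
    by (rule exI[of _ "\<lambda>l. if l = j then (\<lambda>_. 1) else (\<lambda>_. 0)"])
      (auto simp: sum.remove[of UNIV j] hompoly.const hompoly.zero)
  have "\<exists>e. I e (\<lambda>x. x i ^ e)" for i
    by (rule graded_nullstellensatz[OF finite I]) (use nozero If in blast)+
  then obtain e where e: "\<And>i. I (e i) (\<lambda>x. x i ^ e i)" by metis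
  \<comment> \<open>One exponent for all \<open>i\<close>; the summand \<open>d\<close> keeps
    \<open>m - d\<close> a true difference.\<close>
  define m where "m = d + (\<Sum>i\<in>UNIV. e i)"
  have "I m (\<lambda>x. x i ^ m)" for i
  proof -
    have le: "e i \<le> m" unfolding m_def by (simp add: member_le_sum trans_le_add2)
    have "I ((m - e i) + e i) (\<lambda>x. x i ^ (m - e i) * x i ^ e i)"
      by (rule graded_idealD(4)[OF I, OF hompoly_power e]) simp
    then show ?thesis using le by (simp flip: power_add)
  qed
  moreover have "d \<le> m" by (simp add: m_def)
  ultimately have "\<forall>i. \<exists>G. (\<forall>x. x i ^ m = (\<Sum>j\<in>UNIV. G j x * f j x)) \<and> (\<forall>j. hompoly UNIV (m - d) (G j))"
    unfolding I_def by simp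
  then obtain G where "\<And>i x. x i ^ m = (\<Sum>j\<in>UNIV. G i j x * f j x)" "\<And>i j. hompoly UNIV (m - d) (G i j)"
    by metis
  then show ?thesis using \<open>d \<le> m\<close> by blast
qed

section \<open>Relations along a preperiodic orbit\<close>

lemma prod_Times_fiber:
  assumes "finite A" "finite B" "a \<in> A"
  shows "(\<Prod>(k, l)\<in>A \<times> B. h k l ^ (if k = a then m l else 0)) = (\<Prod>l\<in>B. h a l ^ m l)"
proof -
  have "(\<Prod>(k, l)\<in>A \<times> B. h k l ^ (if k = a then m l else 0)) = (\<Prod>k\<in>A. \<Prod>l\<in>B. h k l ^ (if k = a then m l else 0))"
    by (rule prod.cartesian_product[symmetric])
  also have "\<dots> = (\<Prod>k\<in>A. if k = a then \<Prod>l\<in>B. h a l ^ m l else 1)"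
    by (intro prod.cong) auto
  also have "\<dots> = (\<Prod>l\<in>B. h a l ^ m l)" using assms by simp
  finally show ?thesis .
qed

lemma sum_Times_fiber:
  assumes "finite A" "finite B" "a \<in> A"
  shows "(\<Sum>(k, l)\<in>A \<times> B. if k = a then m l else 0) = (\<Sum>l\<in>B. m l :: nat)"
proof -
  have "(\<Sum>(k, l)\<in>A \<times> B. if k = a then m l else 0) = (\<Sum>k\<in>A. \<Sum>l\<in>B. if k = a then m l else 0)"
    by (rule sum.cartesian_product[symmetric])
  also have "\<dots> = (\<Sum>k\<in>A. if k = a then \<Sum>l\<in>B. m l else 0)"
    by (intro sum.cong) auto
  also have "\<dots> = (\<Sum>l\<in>B. m l)" using assms by simp
  finally show ?thesis .
qed

text \<open>All coordinates of the finite orbit form one system of unknowns. Putting the next orbit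
  point for the values of \<open>F\<close> in the Nullstellensatz identity expresses an
  \<open>e\<close>-th power by terms of degree \<open>e - d + 1\<close>, which is below
  \<open>e\<close> as \<open>d \<ge> 2\<close>. The rate in \<open>bounded_int_of_relations\<close>
  depends on the terms of a single relation and not on the number of unknowns, hence not on the
  length of the orbit.\<close>

lemma bounded_preperiodic_vectors:
  fixes F :: "'k::field_char_0 alg_closure ^ 'n::finite \<Rightarrow> 'k alg_closure ^ 'n"
  assumes K: "number_field TYPE('k)" and d: "d \<ge> 2"
    and F: "\<And>j. hompoly UNIV d (\<lambda>x. F (vec_lambda x) $ j)"
    and nz: "\<And>x. x \<noteq> 0 \<Longrightarrow> F x \<noteq> 0"
  shows "\<exists>D r. D > 0 \<and> (\<forall>x n m. m < n \<longrightarrow> (F ^^ n) x = (F ^^ m) x \<longrightarrow> (\<forall>i. bounded_int r (of_int D * x $ i)))"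
proof -
  have "\<exists>j. F (vec_lambda x) $ j \<noteq> 0" if "\<exists>j. x j \<noteq> 0" for x
    using nz[of "vec_lambda x"] that by (auto simp: vec_eq_iff)
  then obtain e G where e: "d \<le> e" and G: "\<And>i j. hompoly UNIV (e - d) (G i j)"
    and eq: "\<And>i x. x i ^ e = (\<Sum>j\<in>UNIV. G i j x * F (vec_lambda x) $ j)"
    using forms_nullstellensatz[of d "\<lambda>j x. F (vec_lambda x) $ j", OF F] by blast
  define M where "M = {m :: 'n \<Rightarrow> nat. (\<Sum>i\<in>UNIV. m i) = e - d}"
  have finM: "finite M" unfolding M_def by (rule finite_exponents)
  have "\<forall>i j. \<exists>c. \<forall>x. G i j x = (\<Sum>m\<in>M. c m * (\<Prod>l\<in>UNIV. x l ^ m l))"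
    unfolding M_def using hompoly_monomials[OF G] by blast
  then obtain c where c: "\<And>i j x. G i j x = (\<Sum>m\<in>M. c i j m * (\<Prod>l\<in>UNIV. x l ^ m l))" by metis
  obtain D g where D: "D > 0" "g \<ge> 1" "\<And>i j m. m \<in> M \<Longrightarrow> bounded_int g (of_int D * c i j m)"
    using common_bounded_multiple[of "(\<lambda>(i, j, m). c i j m) ` (UNIV \<times> UNIV \<times> M)"]
      alg_closure_bounded_multiple[OF K] finM by auto
  define T where "T = (UNIV :: 'n set) \<times> M"
  have finT: "finite T" using finM by (simp add: T_def)
  \<comment> \<open>After scaling the unknowns by \<open>D\<close>, the factor \<open>D ^ e\<close>
    is shared out: one to the coefficient, \<open>e - d\<close> to the monomial, one to the next
    coordinate; \<open>d - 2\<close> remain.\<close>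
  define g' where "g' = real_of_int D ^ (d - 2) * g"
  define r where "r = max 1 (real (card T) * g')"
  have "bounded_int r (of_int D * x $ i)" if mn: "m < n" and per: "(F ^^ n) x = (F ^^ m) x"
    for x :: "'k alg_closure ^ 'n" and n m i
  proof -
    define y where "y = (\<lambda>k. (F ^^ k) x)"
    \<comment> \<open>The successor index, wrapped from \<open>n - 1\<close> to \<open>m\<close> by
      the relation between the two iterates, so that finitely many unknowns are closed under
      \<open>F\<close>.\<close>
    define nx where "nx = (\<lambda>k. if Suc k = n then m else Suc k)"
    have nx: "nx k < n" if "k < n" for k using that mn by (auto simp: nx_def)
    have Fy: "F (y k) = y (nx k)" if "k < n" for k
      using that per by (auto simp: y_def nx_def)
    have rel: "y k $ i ^ e = (\<Sum>(j, m)\<in>T. c i j m * ((\<Prod>l\<in>UNIV. y k $ l ^ m l) * y (nx k) $ j))" if "k < n" for k i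
    proof -
      have "y k $ i ^ e = (\<Sum>j\<in>UNIV. G i j (vec_nth (y k)) * y (nx k) $ j)"
        using eq[of "vec_nth (y k)" i] Fy[OF that] by (simp add: vec_nth_inverse)
      also have "\<dots> = (\<Sum>j\<in>UNIV. \<Sum>m\<in>M. c i j m * ((\<Prod>l\<in>UNIV. y k $ l ^ m l) * y (nx k) $ j))"
        by (simp add: c sum_distrib_right mult.assoc)
      also have "\<dots> = (\<Sum>(j, m)\<in>T. c i j m * ((\<Prod>l\<in>UNIV. y k $ l ^ m l) * y (nx k) $ j))"
        unfolding T_def by (rule sum.cartesian_product)
      finally show ?thesis .
    qed
    define J where "J = {..<n} \<times> (UNIV :: 'n set)"
    define z where "z = (\<lambda>(k, l). of_int D * y k $ l)"
    define C where "C = (\<lambda>(k::nat, i) (j, m). of_int (D ^ (d - 2)) * (of_int D * c i j m))"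
    \<comment> \<open>The two contributions are added, since the next point may be the current one:
      \<open>nx k = k\<close> when \<open>k = m\<close> and \<open>n = Suc m\<close>.\<close>
    define E where "E = (\<lambda>(k, i::'n) (j::'n, m) (k', l). (if k' = k then m l else 0) + (if (k', l) = (nx k, j) then 1 else (0::nat)))"
    have E: "E (k, i) (j, m) q = (case q of (k', l) \<Rightarrow> if k' = k then m l else 0) + (if q = (nx k, j) then 1 else 0)"
      for k i j m q by (cases q) (simp add: E_def)
    have finJ: "finite J" by (simp add: J_def)
    have "bounded_int r (z (0, i))"
    proof (rule bounded_int_of_relations[where J = J and T = T and z = z and c = C and e = "\<lambda>_. e" and E = E and g = g'])
      show "finite J" "finite T" by fact+
      fix p t assume "p \<in> J" "t \<in> T"
      then obtain k i j m where p: "p = (k, i)" "k < n" and t: "t = (j, m)" "m \<in> M"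
        by (auto simp: J_def T_def)
      have "bounded_int (\<bar>real_of_int (D ^ (d - 2))\<bar> * g) (C p t)"
        unfolding C_def p t prod.case by (rule bounded_int_scale[OF D(3)[OF t(2)]])
      then show "bounded_int g' (C p t)" using D(1) by (simp add: g'_def power_abs)
      have "(\<Sum>q\<in>J. E p t q) = (\<Sum>(k', l)\<in>J. if k' = k then m l else 0) + (\<Sum>q\<in>J. if q = (nx k, j) then 1 else 0)"
        unfolding p t E sum.distrib ..
      also have "\<dots> = (\<Sum>l\<in>UNIV. m l) + 1"
        using p nx[OF p(2)] finJ unfolding J_def by (subst sum_Times_fiber) auto
      also have "\<dots> < e" using t(2) d e by (simp add: M_def)
      finally show "(\<Sum>q\<in>J. E p t q) < e" .
    next
      fix p assume "p \<in> J"
      then obtain k i where p: "p = (k, i)" "k < n" by (auto simp: J_def)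
      have prodE: "(\<Prod>q\<in>J. z q ^ E p (j, m) q) = (\<Prod>l\<in>UNIV. z (k, l) ^ m l) * z (nx k, j)" for j m
      proof -
        have "(\<Prod>q\<in>J. z q ^ E p (j, m) q) = (\<Prod>(k', l)\<in>J. z (k', l) ^ (if k' = k then m l else 0)) *
            (\<Prod>q\<in>J. z q ^ (if q = (nx k, j) then 1 else 0))"
          unfolding p E power_add prod.distrib by (simp add: case_prod_unfold)
        also have "(\<Prod>(k', l)\<in>J. z (k', l) ^ (if k' = k then m l else 0)) = (\<Prod>l\<in>UNIV. z (k, l) ^ m l)"
          unfolding J_def using p by (intro prod_Times_fiber) auto
        also have "(\<Prod>q\<in>J. z q ^ (if q = (nx k, j) then 1 else 0)) = z (nx k, j)"
          using finJ nx[OF p(2)] by (subst prod.remove[of J "(nx k, j)"]) (auto simp: J_def intro!: prod.neutral)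
        finally show ?thesis .
      qed
      have "z p ^ e = of_int D ^ e * (\<Sum>(j, m)\<in>T. c i j m * ((\<Prod>l\<in>UNIV. y k $ l ^ m l) * y (nx k) $ j))"
        unfolding rel[OF p(2), symmetric] by (simp add: z_def p power_mult_distrib)
      also have "\<dots> = (\<Sum>t\<in>T. C p t * (\<Prod>q\<in>J. z q ^ E p t q))"
        unfolding sum_distrib_left
      proof (rule sum.cong[OF refl])
        fix t assume "t \<in> T"
        then obtain j m where t: "t = (j, m)" "m \<in> M" by (auto simp: T_def)
        have "(\<Prod>l\<in>UNIV. z (k, l) ^ m l) = of_int D ^ (e - d) * (\<Prod>l\<in>UNIV. y k $ l ^ m l)"
          using t(2) by (simp add: z_def power_mult_distrib prod.distrib power_sum[symmetric] M_def)
        moreover have "e = (d - 2) + 1 + (e - d) + 1" using d e by simp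
        then have "(of_int D :: 'k alg_closure) ^ e = of_int D ^ (d - 2) * of_int D * of_int D ^ (e - d) * of_int D"
          by (metis power_add power_one_right)
        ultimately show "of_int D ^ e * (case t of (j, m) \<Rightarrow> c i j m * ((\<Prod>l\<in>UNIV. y k $ l ^ m l) * y (nx k) $ j)) =
            C p t * (\<Prod>q\<in>J. z q ^ E p t q)"
          unfolding t prodE by (simp add: C_def p z_def)
      qed
      finally show "z p ^ e = (\<Sum>t\<in>T. C p t * (\<Prod>q\<in>J. z q ^ E p t q))" .
    qed (use mn in \<open>auto simp: r_def J_def\<close>)
    then show ?thesis by (simp add: z_def y_def)
  qed
  then show ?thesis using D(1) by blast
qed

section \<open>Counting rational points\<close>

lemma bounded_int_det:
  fixes A :: "'a::field_char_0 ^ 'n::finite ^ 'n"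
  assumes "\<And>i j. bounded_int r (A $ i $ j)"
  shows "bounded_int (fact CARD('n) * r ^ CARD('n)) (det A)"
proof -
  have fin: "finite {p :: 'n \<Rightarrow> 'n. p permutes UNIV}" by (rule finite_permutations) simp
  have "bounded_int (\<Sum>p | p permutes (UNIV :: 'n set). \<bar>real_of_int (sign p)\<bar> * (\<Prod>i\<in>(UNIV :: 'n set). r)) (det A)"
    unfolding det_def using assms fin
    by (intro bounded_int_sum bounded_int_scale bounded_int_prod) auto
  moreover have "(\<Sum>p | p permutes (UNIV :: 'n set). \<bar>real_of_int (sign p)\<bar> * (\<Prod>i\<in>(UNIV :: 'n set). r)) =
      fact CARD('n) * r ^ CARD('n)"
  proof -
    have "\<bar>real_of_int (sign p)\<bar> = 1" for p :: "'n \<Rightarrow> 'n" by (simp add: sign_def)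
    then show ?thesis by (simp add: card_permutations[of "UNIV :: 'n set"])
  qed
  ultimately show ?thesis by simp
qed

text \<open>The coordinate at 1 in a basis of the closure over the base field that contains 1.
  Linearity over the base field is what lets linear systems descend.\<close>

lemma alg_closure_retraction:
  "\<exists>h :: 'k::field alg_closure \<Rightarrow> 'k. (\<forall>x y. h (x + y) = h x + h y) \<and>
     (\<forall>c x. h (to_ac c * x) = c * h x) \<and> h 1 = 1"
proof -
  interpret V: vector_space "\<lambda>c x. to_ac (c :: 'k) * x"
    by unfold_locales (simp_all add: algebra_simps)
  have ind: "V.independent {1}" by (simp add: V.dependent_single)
  define B where "B = V.extend_basis {1}"
  have B: "V.independent B" "V.span B = UNIV" "1 \<in> B"
    using V.independent_extend_basis[OF ind] V.span_extend_basis[OF ind] V.extend_basis_superset[OF ind]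
    unfolding B_def by auto
  show ?thesis
  proof (intro exI[of _ "\<lambda>x. V.representation B x 1"] conjI allI)
    show "V.representation B (x + y) 1 = V.representation B x 1 + V.representation B y 1" for x y
      using V.representation_add[OF B(1)] B(2) by simp
    show "V.representation B (to_ac c * x) 1 = c * V.representation B x 1" for c x
      using V.representation_scale[OF B(1)] B(2) by simp
    show "V.representation B 1 1 = 1" using V.representation_basis[OF B(1,3)] by simp
  qed
qed

text \<open>The retraction turns the solution \<open>a\<close> into a solution with entries in the
  base field, and independence over the closure makes the two equal.\<close>

lemma rational_coordinates:
  fixes p :: "'i \<Rightarrow> 'k::field ^ 'n" and q :: "'k ^ 'n"
  assumes J: "finite J"
    and eq: "\<And>l. to_ac (q $ l) = (\<Sum>i\<in>J. a i * to_ac (p i $ l))"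
    and ind: "\<And>c. (\<And>l. (\<Sum>i\<in>J. c i * to_ac (p i $ l)) = 0) \<Longrightarrow> (\<forall>i\<in>J. c i = 0)"
    and i: "i \<in> J"
  shows "a i \<in> range to_ac"
proof -
  obtain h :: "'k alg_closure \<Rightarrow> 'k" where h: "\<And>x y. h (x + y) = h x + h y"
    "\<And>c x. h (to_ac c * x) = c * h x" "h 1 = 1" using alg_closure_retraction by blast
  have hac: "h (to_ac c) = c" for c using h(2)[of c 1] h(3) by simp
  have hmult: "h (x * to_ac c) = h x * c" for c x using h(2)[of c x] by (simp add: mult.commute)
  have h0: "h 0 = 0" using hac[of 0] by simp
  have hsum: "h (\<Sum>i\<in>J. f i) = (\<Sum>i\<in>J. h (f i))" for f :: "'i \<Rightarrow> _"
    using J by (induction J rule: finite_induct) (auto simp: h h0)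
  have "q $ l = (\<Sum>i\<in>J. h (a i) * p i $ l)" for l
    using arg_cong[OF eq[of l], of h] by (simp add: hac hsum hmult)
  then have "(\<Sum>i\<in>J. (a i - to_ac (h (a i))) * to_ac (p i $ l)) = 0" for l
    using eq[of l] by (simp add: left_diff_distrib sum_subtractf to_ac_sum)
  then have "a i - to_ac (h (a i)) = 0" using ind[of "\<lambda>i. a i - to_ac (h (a i))"] i by auto
  then show ?thesis by (metis eq_iff_diff_eq_0 rangeI)
qed

text \<open>The vectors \<open>x P\<close> are bounded lifts of points which a common linear map \<open>A\<close> sends to
  \<open>'k\<close>-rational points. Cross-ratios of their coordinates with respect to a basis chosen among them
  are rational, and are quotients of determinants of bounded entries.\<close>

lemma card_projectively_rational_le:
  fixes p :: "'i \<Rightarrow> 'k::field_char_0 ^ 'n::finite" and x :: "'i \<Rightarrow> 'k alg_closure ^ 'n"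
    and A :: "'k alg_closure ^ 'n ^ 'n"
  defines "Q r \<equiv> insert (0::'k) {\<kappa>. \<exists>u w. w \<noteq> 0 \<and> bounded_int r u \<and> bounded_int r w \<and> to_ac \<kappa> * w = u}"
  assumes K: "number_field TYPE('k)" and A: "invertible A" and r: "r \<ge> 1"
    and x0: "\<And>P. P \<in> S \<Longrightarrow> x P \<noteq> 0" and \<mu>0: "\<And>P. P \<in> S \<Longrightarrow> \<mu> P \<noteq> 0"
    and Ax: "\<And>P. P \<in> S \<Longrightarrow> A *v x P = \<mu> P *s (\<chi> i. to_ac (p P $ i))"
    and bdd: "\<And>P i. P \<in> S \<Longrightarrow> bounded_int r (x P $ i)"
    and inj: "\<And>P P' c. P \<in> S \<Longrightarrow> P' \<in> S \<Longrightarrow> x P = c *s x P' \<Longrightarrow> P = P'"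
  shows "finite S \<and> card S \<le> 2 ^ CARD('n) * card (Q ((fact CARD('n) * r ^ CARD('n)) ^ 2)) ^ CARD('n)"
proof -
  define b where "b = fact CARD('n) * r ^ CARD('n)"
  \<comment> \<open>The basis is chosen among the lifts, so that \<open>A\<close> sends its members
    to rational vectors up to scalars.\<close>
  obtain C where C: "C \<subseteq> x ` S" "vec.independent C" "x ` S \<subseteq> vec.span C"
    using vec.maximal_independent_subset[of "x ` S"] by blast
  \<comment> \<open>The lifts may span a proper subspace; standard basis vectors, bounded because
    \<open>r \<ge> 1\<close>, complete \<open>C\<close> to a square matrix.\<close>
  obtain B where B: "C \<subseteq> B" "B \<subseteq> C \<union> cart_basis" "vec.independent B" "C \<union> cart_basis \<subseteq> vec.span B"
    using vec.maximal_independent_subset_extend[of C "C \<union> cart_basis"] C(2) by blast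
  have finB: "finite B" and finC: "finite C" using vec.finiteI_independent B(3) C(2) by blast+
  have spanB: "vec.span B = UNIV"
    using vec.span_mono[of cart_basis "vec.span B"] B(4) by (simp add: vec.span_span) auto
  have "card B = CARD('n)"
    using vec.dim_eq_card[of B UNIV] spanB B(3) vec.dim_UNIV by (simp add: vec.dim_UNIV vec.dimension_def card_cart_basis)
  then obtain y :: "'n \<Rightarrow> _" where y: "bij_betw y UNIV B"
    using finite_same_card_bij[of "UNIV :: 'n set" B] finB by auto
  define Y where "Y = (\<chi> i. y i)"
  have rowY: "row i Y = y i" for i by (simp add: row_def Y_def vec_eq_iff)
  have "rows Y = B" unfolding rows_def rowY using y by (auto simp: bij_betw_def)
  then have "\<exists>Z. Z ** Y = mat 1" using matrix_left_invertible_span_rows_gen[of Y] spanB by simp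
  then have invY: "invertible Y" by (simp add: invertible_left_inverse)
  then have detY: "det Y \<noteq> 0" by (simp add: invertible_det_nz)
  have indY: "c i = 0" if "(\<Sum>i\<in>UNIV. c i *s y i) = 0" for c i
    using invY that unfolding invertible_right_inverse matrix_right_invertible_independent_rows rowY by blast
  define J where "J = {i. y i \<in> C}"
  have ybij: "bij_betw y J C" using y B(1) unfolding J_def bij_betw_def by (auto simp: inj_on_def)
  have "\<exists>c. x P = (\<Sum>i\<in>UNIV. c i *s y i) \<and> (\<forall>i. i \<notin> J \<longrightarrow> c i = 0)" if P: "P \<in> S" for P
  proof -
    have "x P \<in> vec.span C" using C(3) P by auto
    then obtain u where u: "x P = (\<Sum>v\<in>C. u v *s v)" using vec.span_finite[OF finC] by auto
    have "x P = (\<Sum>i\<in>J. u (y i) *s y i)"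
      unfolding u by (rule sum.reindex_bij_betw[OF ybij, symmetric])
    also have "\<dots> = (\<Sum>i\<in>UNIV. (if i \<in> J then u (y i) else 0) *s y i)"
      by (rule sum.mono_neutral_cong_left) auto
    finally show ?thesis by (intro exI[of _ "\<lambda>i. if i \<in> J then u (y i) else 0"]) auto
  qed
  then obtain c where xc: "\<And>P. P \<in> S \<Longrightarrow> x P = (\<Sum>i\<in>UNIV. c P i *s y i)"
    and cJ: "\<And>P i. P \<in> S \<Longrightarrow> i \<notin> J \<Longrightarrow> c P i = 0" by metis
  have y_bdd: "bounded_int r (y i $ j)" for i j
  proof -
    have "y i \<in> x ` S \<union> cart_basis" using y B(2) C(1) by (auto simp: bij_betw_def)
    then show ?thesis
    proof
      assume "y i \<in> x ` S" then show ?thesis using bdd by auto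
    next
      assume "y i \<in> cart_basis"
      then obtain k where "y i = axis k 1" by (auto simp: cart_basis_def)
      then show ?thesis using r bounded_int_mono[OF bounded_int_1 r] bounded_int_0[of r]
        by (auto simp: axis_def)
    qed
  qed
  \<comment> \<open>By Cramer's rule this multiple of a coordinate is a determinant with bounded
    entries; the common factor \<open>det Y\<close> will cancel in quotients.\<close>
  have det_bdd: "bounded_int b (c P k * det Y)" if P: "P \<in> S" for P k
  proof -
    have "c P k * det Y = det (\<chi> i. if i = k then x P else y i)"
      using cramer_lemma_transpose[of k "\<chi> i. c P i" Y] unfolding rowY vec_lambda_beta xc[OF P, symmetric] by simp
    also have "bounded_int b \<dots>"
      unfolding b_def using bdd[OF P] y_bdd by (intro bounded_int_det) auto
    finally show ?thesis .
  qed
  have "\<forall>i\<in>J. \<exists>P\<in>S. x P = y i" using C(1) unfolding J_def by (metis imageE mem_Collect_eq subsetD)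
  then obtain \<pi> where \<pi>: "\<And>i. i \<in> J \<Longrightarrow> \<pi> i \<in> S" "\<And>i. i \<in> J \<Longrightarrow> x (\<pi> i) = y i" by metis
  \<comment> \<open>Coordinates of \<open>p P\<close> with respect to the vectors
    \<open>p (\<pi> i)\<close>: those of \<open>x P\<close>, corrected by the scalars \<mu>.\<close>
  define a where "a = (\<lambda>P i. c P i * \<mu> (\<pi> i) / \<mu> P)"
  obtain A' where A': "A' ** A = mat 1" using A by (auto simp: invertible_def)
  have a_rat: "a P i \<in> range to_ac" if P: "P \<in> S" and i: "i \<in> J" for P i
  proof (rule rational_coordinates[of J "p P" "a P" "\<lambda>i. p (\<pi> i)"])
    have "\<mu> P *s (\<chi> i. to_ac (p P $ i)) = A *v (\<Sum>i\<in>UNIV. c P i *s y i)"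
      using Ax[OF P] xc[OF P] by simp
    also have "\<dots> = A *v (\<Sum>i\<in>J. c P i *s y i)"
      using cJ[OF P] by (intro arg_cong[where f = "\<lambda>v. A *v v"] sum.mono_neutral_right) auto
    also have "\<dots> = (\<Sum>i\<in>J. c P i *s (A *v y i))"
      by (simp add: vec.linear_sum[OF matrix_vector_mul_linear_gen] vector_scalar_commute)
    also have "\<dots> = (\<Sum>i\<in>J. c P i *s (\<mu> (\<pi> i) *s (\<chi> l. to_ac (p (\<pi> i) $ l))))"
      using \<pi> Ax by (intro sum.cong refl) metis
    finally have eq: "\<mu> P *s (\<chi> i. to_ac (p P $ i)) = (\<Sum>i\<in>J. c P i *s (\<mu> (\<pi> i) *s (\<chi> l. to_ac (p (\<pi> i) $ l))))" .
    show "to_ac (p P $ l) = (\<Sum>i\<in>J. a P i * to_ac (p (\<pi> i) $ l))" for l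
    proof -
      have "\<mu> P * to_ac (p P $ l) = (\<Sum>i\<in>J. c P i * (\<mu> (\<pi> i) * to_ac (p (\<pi> i) $ l)))"
        using arg_cong[OF eq, of "\<lambda>v. v $ l"] by (simp add: sum_component mult.assoc)
      then have "to_ac (p P $ l) = (\<Sum>i\<in>J. c P i * (\<mu> (\<pi> i) * to_ac (p (\<pi> i) $ l))) / \<mu> P"
        using \<mu>0[OF P] by (simp add: field_simps)
      then show ?thesis by (simp add: a_def sum_divide_distrib mult.assoc)
    qed
    show "\<forall>i\<in>J. g i = 0" if g: "\<And>l. (\<Sum>i\<in>J. g i * to_ac (p (\<pi> i) $ l)) = 0" for g
    proof -
      define g' where "g' = (\<lambda>i. if i \<in> J then g i / \<mu> (\<pi> i) else 0)"
      have "A *v (\<Sum>i\<in>UNIV. g' i *s y i) = A *v (\<Sum>i\<in>J. g' i *s y i)"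
        by (intro arg_cong[where f = "\<lambda>v. A *v v"] sum.mono_neutral_right) (auto simp: g'_def)
      also have "\<dots> = (\<Sum>i\<in>J. g' i *s (A *v y i))"
        by (simp add: vec.linear_sum[OF matrix_vector_mul_linear_gen] vector_scalar_commute)
      also have "\<dots> = (\<Sum>i\<in>J. g i *s (\<chi> l. to_ac (p (\<pi> i) $ l)))"
      proof (intro sum.cong refl)
        fix i assume i: "i \<in> J"
        have "A *v y i = \<mu> (\<pi> i) *s (\<chi> l. to_ac (p (\<pi> i) $ l))" using Ax[OF \<pi>(1)[OF i]] \<pi>(2)[OF i] by simp
        then show "g' i *s (A *v y i) = g i *s (\<chi> l. to_ac (p (\<pi> i) $ l))"
          using i \<mu>0[OF \<pi>(1)[OF i]] by (simp add: g'_def vector_smult_assoc)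
      qed
      also have "\<dots> = 0" using g by (simp add: vec_eq_iff sum_component)
      finally have "A' *v (A *v (\<Sum>i\<in>UNIV. g' i *s y i)) = 0" by simp
      then have "(\<Sum>i\<in>UNIV. g' i *s y i) = 0" by (simp add: matrix_vector_mul_assoc A')
      then have "g' i = 0" for i using indY by blast
      then show ?thesis using \<mu>0 \<pi>(1) by (auto simp: g'_def split: if_splits) (metis divide_eq_0_iff)
    qed
  qed (use i in auto)
  define supp where "supp = (\<lambda>P. {i. c P i \<noteq> 0})"
  \<comment> \<open>Each support that occurs gets one reference point and a distinguished index.
    Comparing \<open>P\<close> with this reference at two indices gives the cross-ratio \<kappa>, in
    which all scalars \<mu> cancel.\<close>
  define ref where "ref = (\<lambda>I. SOME P. P \<in> S \<and> supp P = I)"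
  define idx where "idx = (\<lambda>I::'n set. SOME i. i \<in> I)"
  have ref: "ref (supp P) \<in> S" "supp (ref (supp P)) = supp P" if "P \<in> S" for P
    using someI[of "\<lambda>R. R \<in> S \<and> supp R = supp P" P] that unfolding ref_def by auto
  have idx: "idx (supp P) \<in> supp P" if P: "P \<in> S" for P
  proof -
    have "supp P \<noteq> {}"
    proof
      assume "supp P = {}"
      then have "c P i = 0" for i by (auto simp: supp_def)
      then show False using x0[OF P] xc[OF P] by simp
    qed
    then show ?thesis unfolding idx_def by (metis all_not_in_conv someI_ex)
  qed
  have suppJ: "i \<in> J" if "P \<in> S" "i \<in> supp P" for P i using cJ that by (auto simp: supp_def)
  define \<kappa> where "\<kappa> = (\<lambda>P j. c P j * c (ref (supp P)) (idx (supp P)) / (c P (idx (supp P)) * c (ref (supp P)) j))"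
  have \<kappa>_a: "\<kappa> P j = a P j * a (ref (supp P)) (idx (supp P)) / (a P (idx (supp P)) * a (ref (supp P)) j)"
    if "P \<in> S" "j \<in> supp P" for P j
    unfolding \<kappa>_def a_def
    using \<mu>0[OF that(1)] \<mu>0[OF ref(1)[OF that(1)]] \<mu>0[OF \<pi>(1)[OF suppJ[OF that]]]
      \<mu>0[OF \<pi>(1)[OF suppJ[OF that(1) idx[OF that(1)]]]]
    by (simp add: divide_simps)
  have \<kappa>_rat: "to_ac (of_ac (\<kappa> P j)) = \<kappa> P j" if "P \<in> S" "j \<in> supp P" for P j
  proof (rule to_ac_of_ac)
    have *: "a P j \<in> range to_ac" "a (ref (supp P)) (idx (supp P)) \<in> range to_ac"
      "a P (idx (supp P)) \<in> range to_ac" "a (ref (supp P)) j \<in> range to_ac"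
      using that ref[OF that(1)] idx[OF that(1)] suppJ[OF that(1)] by (auto intro!: a_rat)
    then obtain k1 k2 k3 k4 where "a P j = to_ac k1" "a (ref (supp P)) (idx (supp P)) = to_ac k2"
      "a P (idx (supp P)) = to_ac k3" "a (ref (supp P)) j = to_ac k4" by blast
    then have "\<kappa> P j = to_ac (k1 * k2 / (k3 * k4))" using \<kappa>_a[OF that] by simp
    then show "\<kappa> P j \<in> range to_ac" by blast
  qed
  \<comment> \<open>Off the support 0 is a default value, supplied in \<open>Q\<close> by the
    \<open>insert\<close>.\<close>
  define k where "k = (\<lambda>P j. if j \<in> supp P then of_ac (\<kappa> P j) else 0)"
  have kQ: "k P j \<in> Q (b ^ 2)" if P: "P \<in> S" for P j
  proof (cases "j \<in> supp P")
    case True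
    define R i where "R = ref (supp P)" and "i = idx (supp P)"
    have nz: "c P i \<noteq> 0" "c R j \<noteq> 0"
      using idx[OF P] ref(2)[OF P] True by (auto simp: R_def i_def supp_def)
    have "bounded_int (b ^ 2) ((c P j * det Y) * (c R i * det Y))" "bounded_int (b ^ 2) ((c P i * det Y) * (c R j * det Y))"
      unfolding power2_eq_square using P ref(1)[OF P] by (auto intro!: bounded_int_mult det_bdd simp: R_def)
    moreover have "(c P i * det Y) * (c R j * det Y) \<noteq> 0" using nz detY by simp
    moreover have "to_ac (k P j) * ((c P i * det Y) * (c R j * det Y)) = (c P j * det Y) * (c R i * det Y)"
      using True \<kappa>_rat[OF P True] nz by (simp add: k_def \<kappa>_def R_def[symmetric] i_def[symmetric])
    ultimately show ?thesis unfolding Q_def by blast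
  qed (simp add: k_def Q_def)
  define \<Phi> where "\<Phi> = (\<lambda>P. (supp P, k P))"
  define T where "T = Pow (UNIV :: 'n set) \<times> ((UNIV :: 'n set) \<rightarrow>\<^sub>E Q (b ^ 2))"
  \<comment> \<open>Once the support is known, the cross-ratios against its reference point
    determine the coordinates of \<open>P\<close> up to the scalar \<open>t\<close>.\<close>
  have "inj_on \<Phi> S"
  proof (rule inj_onI)
    fix P P' assume P: "P \<in> S" "P' \<in> S" "\<Phi> P = \<Phi> P'"
    then have s: "supp P' = supp P" and kk: "k P = k P'" by (auto simp: \<Phi>_def)
    define R i where "R = ref (supp P)" and "i = idx (supp P)"
    have i: "c P i \<noteq> 0" "c P' i \<noteq> 0" "c R i \<noteq> 0"
      using idx[OF P(1)] ref(2)[OF P(1)] s by (auto simp: i_def R_def supp_def)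
    define t where "t = c P i / c P' i"
    have "c P j = t * c P' j" for j
    proof (cases "j \<in> supp P")
      case True
      then have "\<kappa> P j = \<kappa> P' j" using \<kappa>_rat[OF P(1)] \<kappa>_rat[OF P(2)] fun_cong[OF kk, of j] s by (metis k_def)
      moreover have "c R j \<noteq> 0" using True ref(2)[OF P(1)] by (auto simp: R_def supp_def)
      ultimately show ?thesis using i by (simp add: \<kappa>_def s R_def[symmetric] i_def[symmetric] t_def field_simps)
    next
      case False
      then have "c P j = 0" "c P' j = 0" using s by (auto simp: supp_def)
      then show ?thesis by simp
    qed
    then have "x P = t *s x P'"
      unfolding xc[OF P(1)] xc[OF P(2)] vec.scale_sum_right vector_smult_assoc by simp
    then show "P = P'" using inj P by blast
  qed
  moreover have "\<Phi> ` S \<subseteq> T" using kQ unfolding \<Phi>_def T_def by auto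
  moreover have "finite T" unfolding T_def Q_def
    using finite_bounded_quotients[OF K] by (intro finite_cartesian_product finite_PiE) auto
  ultimately have "finite S" "card S \<le> card T"
    by (meson inj_on_finite, meson card_inj_on_le)
  moreover have "card T = 2 ^ CARD('n) * card (Q (b ^ 2)) ^ CARD('n)"
    unfolding T_def by (simp add: card_cartesian_product card_Pow card_PiE)
  ultimately show ?thesis by (simp add: b_def)
qed

section \<open>From polynomials and rational points to lifts\<close>

lemma hompoly_mpoly_eval:
  assumes "homogeneous d p"
  shows "hompoly UNIV d (\<lambda>x. mpoly_eval p (vec_lambda x))"
  unfolding mpoly_eval_def
proof (rule hompoly_sum)
  fix m assume "m \<in> Poly_Mapping.keys p"
  then have "(\<Sum>i\<in>UNIV. Poly_Mapping.lookup m i) = d" using assms by (auto simp: homogeneous_def)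
  then show "hompoly UNIV d (\<lambda>x. Poly_Mapping.lookup p m * (\<Prod>i\<in>UNIV. vec_lambda x $ i ^ Poly_Mapping.lookup m i))"
    using hompoly_scale[OF hompoly_prod[of UNIV UNIV "Poly_Mapping.lookup m" "\<lambda>i x. x i ^ Poly_Mapping.lookup m i"]]
    by (simp add: hompoly_power)
qed simp

lemma homogeneous_map_to_ac: "homogeneous d p \<Longrightarrow> homogeneous d (Poly_Mapping.map to_ac p)"
  unfolding homogeneous_def by (auto simp: in_keys_iff Poly_Mapping.map.rep_eq when_def split: if_splits)

lemma proj_rel_refl: "x \<noteq> 0 \<Longrightarrow> proj_rel x x"
  unfolding proj_rel_def by (metis one_neq_zero vector_smult_lid)

lemma proj_to_ac_proj_pt:
  assumes "p \<noteq> 0"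
  shows "proj_to_ac (proj_pt p) = proj_pt (\<chi> i. to_ac (p $ i))"
proof -
  have "(\<chi> i. to_ac (p $ i)) \<noteq> 0" using assms by (auto simp: vec_eq_iff)
  then show ?thesis
    using assms by (simp add: proj_pt_def proj_to_ac.abs_eq proj_rel_refl)
qed

text \<open>The scalar between two rational vectors is a quotient of rational coordinates, hence
  itself rational.\<close>

lemma inj_proj_to_ac: "inj proj_to_ac"
proof (rule injI)
  fix P P' :: "('k::field, 'n::finite) proj_space"
  assume eq: "proj_to_ac P = proj_to_ac P'"
  obtain p p' where p: "p \<noteq> 0" "P = proj_pt p" and p': "p' \<noteq> 0" "P' = proj_pt p'"
    using proj_pt_surj by metis
  have "(\<chi> i. to_ac (p $ i)) \<noteq> 0" "(\<chi> i. to_ac (p' $ i)) \<noteq> 0"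
    using p p' by (auto simp: vec_eq_iff)
  then obtain c where c: "c \<noteq> 0" "(\<chi> i. to_ac (p' $ i)) = c *s (\<chi> i. to_ac (p $ i))"
    using eq p p' by (auto simp: proj_to_ac_proj_pt proj_pt_eq_iff)
  then have ci: "to_ac (p' $ i) = c * to_ac (p $ i)" for i by (simp add: vec_eq_iff)
  obtain j where j: "p $ j \<noteq> 0" using p by (auto simp: vec_eq_iff)
  define k where "k = p' $ j / p $ j"
  have ck: "c = to_ac k" using ci[of j] j by (simp add: k_def field_simps)
  have "to_ac (p' $ i) = to_ac (k * p $ i)" for i using ci[of i] unfolding ck by simp
  then have "p' $ i = k * p $ i" for i by (simp only: to_ac_eq_iff)
  then have "p' = k *s p" by (simp add: vec_eq_iff)
  moreover have "k \<noteq> 0" using c(1) ck by auto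
  ultimately show "P = P'" using p p' by (auto simp: proj_pt_eq_iff)
qed

lemma funpow_conj:
  assumes "\<And>x. g (f x) = f (h x)"
  shows "(g ^^ n) (f x) = f ((h ^^ n) x)"
  by (induction n) (simp_all add: assms)

text \<open>After rescaling a lift, the relation between two points of its orbit is an equality of vectors,
  because the base field is algebraically closed.\<close>

lemma preperiodic_lift:
  fixes F :: "'a::{alg_closed_field,field_char_0} ^ 'n::finite \<Rightarrow> 'a ^ 'n"
  assumes d: "d \<ge> 2"
    and F: "\<And>j. hompoly UNIV d (\<lambda>x. F (vec_lambda x) $ j)"
    and nz: "\<And>x. x \<noteq> 0 \<Longrightarrow> F x \<noteq> 0"
    and \<phi>: "\<And>x. x \<noteq> 0 \<Longrightarrow> \<phi> (proj_pt x) = proj_pt (F x)"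
    and pre: "preperiodic \<phi> (proj_pt y)" and y: "y \<noteq> 0"
  obtains c m n where "c \<noteq> 0" "m < n" "(F ^^ n) (c *s y) = (F ^^ m) (c *s y)"
proof -
  have Fscale: "F (c *s x) = c ^ d *s F x" for c x
  proof -
    have "F (vec_lambda (\<lambda>i. c * x $ i)) $ j = c ^ d * F (vec_lambda (vec_nth x)) $ j" for j
      by (rule hompoly_homogeneous[OF F])
    moreover have "vec_lambda (\<lambda>i. c * x $ i) = c *s x" by (simp add: vec_eq_iff)
    ultimately show ?thesis by (simp add: vec_eq_iff vec_nth_inverse)
  qed
  have Fn: "(F ^^ n) (c *s x) = c ^ (d ^ n) *s (F ^^ n) x" for n c x
    by (induction n) (auto simp: Fscale power_mult[symmetric] mult.commute)
  have Fnz: "(F ^^ n) y \<noteq> 0" for n using y nz by (induction n) auto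
  have \<phi>n: "(\<phi> ^^ n) (proj_pt y) = proj_pt ((F ^^ n) y)" for n
    by (induction n) (auto simp: \<phi> Fnz)
  obtain n m where mn: "m < n" "(\<phi> ^^ n) (proj_pt y) = (\<phi> ^^ m) (proj_pt y)"
    using pre unfolding preperiodic_def by blast
  then obtain b where b: "b \<noteq> 0" "(F ^^ m) y = b *s (F ^^ n) y"
    using Fnz by (auto simp: \<phi>n proj_pt_eq_iff)
  \<comment> \<open>Scaling \<open>y\<close> by \<open>c\<close> multiplies the two orbit vectors by
    \<open>c ^ (d ^ n)\<close> and \<open>c ^ (d ^ m)\<close>. The exponents differ because
    \<open>d \<ge> 2\<close>, so a suitable root of \<open>b\<close> makes the vectors
    equal.\<close>
  have lt: "d ^ m < d ^ n" using mn d by simp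
  then obtain c where c: "c ^ (d ^ n - d ^ m) = b" using nth_root_exists[of "d ^ n - d ^ m" b] by auto
  have "d ^ n - d ^ m > 0" using lt by simp
  then have c0: "c \<noteq> 0" using c b(1) by (auto simp: power_0_left)
  have "c ^ (d ^ n) = c ^ (d ^ n - d ^ m) * c ^ (d ^ m)"
    using lt by (simp flip: power_add)
  then have "(F ^^ m) (c *s y) = (F ^^ n) (c *s y)"
    unfolding Fn b(2) by (simp add: vector_smult_assoc c mult.commute)
  then show ?thesis using that[OF c0 mn(1)] by simp
qed

theorem theorem2p8:
  fixes \<phi> :: "('k::field_char_0 alg_closure, 'n::finite) proj_space \<Rightarrow> ('k alg_closure, 'n) proj_space"
    and N d :: nat
  assumes "number_field TYPE('k)"
    and "CARD('n) = N + 1" and "N \<ge> 1" and "d \<ge> 2"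
    and "proj_morphism d \<phi>"
  shows "\<exists>B::nat. \<forall>\<psi>. twist d \<phi> \<psi> \<longrightarrow>
           finite {P :: ('k, 'n) proj_space. preperiodic \<psi> (proj_to_ac P)} \<and>
           card {P :: ('k, 'n) proj_space. preperiodic \<psi> (proj_to_ac P)} \<le> B"
proof -
  obtain F :: "'n \<Rightarrow> ('k, 'n) mpoly" where *: "(\<forall>i. homogeneous d (F i)) \<and>
      (\<forall>x. x \<noteq> 0 \<longrightarrow> eval_ac F x \<noteq> 0) \<and> (\<forall>x. x \<noteq> 0 \<longrightarrow> \<phi> (proj_pt x) = proj_pt (eval_ac F x))"
    using assms(5) unfolding proj_morphism_def by (rule exE)
  have hom: "homogeneous d (F i)" and nz: "x \<noteq> 0 \<Longrightarrow> eval_ac F x \<noteq> 0"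
    and \<phi>: "x \<noteq> 0 \<Longrightarrow> \<phi> (proj_pt x) = proj_pt (eval_ac F x)" for i x
    using * by auto
  have F: "hompoly UNIV d (\<lambda>x. eval_ac F (vec_lambda x) $ j)" for j
    using hompoly_mpoly_eval[OF homogeneous_map_to_ac[OF hom[of j]]] by (simp add: eval_ac_def)
  obtain D r where D: "D > 0" and bdd: "\<And>x n m i. m < n \<Longrightarrow> (eval_ac F ^^ n) x = (eval_ac F ^^ m) x \<Longrightarrow>
      bounded_int r (of_int D * x $ i)"
    using bounded_preperiodic_vectors[where F = "eval_ac F", OF assms(1,4) F nz] by blast
  \<comment> \<open>The counting lemma asks for a rate of at least 1, because standard basis vectors
    enter it.\<close>
  define s where "s = max 1 r"
  have rs: "r \<le> s" "s \<ge> 1" by (auto simp: s_def)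
  show ?thesis
  \<comment> \<open>The bound stays open until the final \<open>show\<close>. It is introduced
    before \<open>\<psi>\<close>, so it can involve \<open>s\<close> and the field but neither
    \<open>\<psi>\<close> nor \<open>f\<close>.\<close>
  proof (intro exI allI impI)
    fix \<psi> assume "twist d \<phi> \<psi>"
    then obtain f where f: "f \<in> PGL" "\<psi> = f \<circ> \<phi> \<circ> inv_into UNIV f" by (auto simp: twist_def proj_conj_def)
    then obtain A where A: "invertible A" "\<And>x. x \<noteq> 0 \<Longrightarrow> f (proj_pt x) = proj_pt (A *v x)"
      unfolding PGL_def by blast
    have bij: "bij f" by (rule bij_PGL[OF f(1)])
    define S where "S = {P :: ('k, 'n) proj_space. preperiodic \<psi> (proj_to_ac P)}"
    \<comment> \<open>Data attached to a rational preperiodic point: a rational vector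
      \<open>p\<close>, a bounded lift \<open>x\<close> of its preimage under \<open>f\<close>, and
      the scalar \<mu> linking them.\<close>
    define good where "good = (\<lambda>P p x \<mu>. p \<noteq> 0 \<and> P = proj_pt p \<and> x \<noteq> 0 \<and> \<mu> \<noteq> 0 \<and>
        A *v x = \<mu> *s (\<chi> i. to_ac (p $ i)) \<and> (\<forall>i. bounded_int s (x $ i)))"
    have "\<exists>p x \<mu>. good P p x \<mu>" if P: "P \<in> S" for P
    proof -
      obtain p where p: "p \<noteq> 0" "P = proj_pt p" using proj_pt_surj by blast
      define q where "q = (\<chi> i. to_ac (p $ i))"
      have q: "q \<noteq> 0" "proj_to_ac P = proj_pt q"
        using p proj_to_ac_proj_pt by (auto simp: q_def vec_eq_iff)
      obtain y where y: "y \<noteq> 0" "inv_into UNIV f (proj_pt q) = proj_pt y" using proj_pt_surj by blast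
      have fy: "f (proj_pt y) = proj_pt q" using bij y(2) by (metis bij_inv_eq_iff)
      have Ay: "A *v y \<noteq> 0"
      proof
        assume *: "A *v y = 0"
        obtain A' where "A' ** A = mat 1" using A(1) by (auto simp: invertible_def)
        then have "y = A' *v (A *v y)" by (simp add: matrix_vector_mul_assoc)
        then show False using * y(1) by simp
      qed
      have "proj_pt q = proj_pt (A *v y)" using fy A(2)[OF y(1)] by simp
      then obtain b where b: "b \<noteq> 0" "A *v y = b *s q" using q(1) Ay by (auto simp: proj_pt_eq_iff)
      have conj: "(\<psi> ^^ n) (f Q) = f ((\<phi> ^^ n) Q)" for n Q
        by (rule funpow_conj) (simp add: f(2) bij_is_inj[OF bij])
      have pre: "preperiodic \<phi> (proj_pt y)"
        using P bij unfolding S_def preperiodic_def mem_Collect_eq q(2) fy[symmetric] conj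
        by (simp add: bij_is_inj inj_eq)
      obtain c m n where c: "c \<noteq> 0" "m < n" "(eval_ac F ^^ n) (c *s y) = (eval_ac F ^^ m) (c *s y)"
        by (rule preperiodic_lift[where F = "eval_ac F", OF assms(4) F nz \<phi> pre y(1)])
      \<comment> \<open>The factor \<open>c\<close> makes the orbit relation exact and
        \<open>D\<close> makes the coordinates bounded; the scalar \<mu> absorbs both.\<close>
      have "good P p ((of_int D * c) *s y) (of_int D * c * b)"
        unfolding good_def
      proof (intro conjI allI)
        show "(of_int D * c) *s y \<noteq> 0" "of_int D * c * b \<noteq> 0" using D c(1) b(1) y(1) by simp_all
        show "A *v ((of_int D * c) *s y) = (of_int D * c * b) *s (\<chi> i. to_ac (p $ i))"
          unfolding q_def[symmetric] by (simp add: vector_scalar_commute b(2) vector_smult_assoc)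
        show "bounded_int s (((of_int D * c) *s y) $ i)" for i
          using bounded_int_mono[OF bdd[OF c(2,3)] rs(1), of i] by (simp add: mult.assoc)
      qed (use p in auto)
      then show ?thesis by blast
    qed
    then obtain p x \<mu> where good: "\<And>P. P \<in> S \<Longrightarrow> good P (p P) (x P) (\<mu> P)" by metis
    \<comment> \<open>Proportional lifts have proportional images under \<open>A\<close>, so the two
      points agree over the closure, and \<open>inj_proj_to_ac\<close> brings this down to the
      number field.\<close>
    have inj: "P = P'" if PP: "P \<in> S" "P' \<in> S" "x P = c *s x P'" for P P' c
    proof -
      have g: "good P (p P) (x P) (\<mu> P)" "good P' (p P') (x P') (\<mu> P')" using good PP(1,2) by blast+
      have "c \<noteq> 0" using g(1) PP(3) unfolding good_def by auto
      define q where "q = (\<lambda>P. \<chi> i. to_ac (p P $ i))"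
      have q0: "q P \<noteq> 0" "q P' \<noteq> 0" using g by (auto simp: good_def q_def vec_eq_iff)
      have "\<mu> P *s q P = A *v (c *s x P')" using g PP(3) by (simp add: good_def q_def)
      also have "\<dots> = (c * \<mu> P') *s q P'"
        using g by (simp add: good_def q_def vector_scalar_commute vector_smult_assoc)
      finally have "inverse (\<mu> P) *s (\<mu> P *s q P) = inverse (\<mu> P) *s ((c * \<mu> P') *s q P')" by simp
      then have "q P = (inverse (\<mu> P) * (c * \<mu> P')) *s q P'"
        using g by (simp add: good_def vector_smult_assoc)
      moreover have "inverse (\<mu> P) * (c * \<mu> P') \<noteq> 0" using g \<open>c \<noteq> 0\<close> by (simp add: good_def)
      ultimately have "proj_pt (q P') = proj_pt (q P)" using q0 proj_pt_eq_iff by blast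
      then have "proj_to_ac P' = proj_to_ac P"
        using g proj_to_ac_proj_pt unfolding good_def q_def by metis
      then show ?thesis using inj_proj_to_ac by (metis injD)
    qed
    have "finite S \<and> card S \<le> 2 ^ CARD('n) * card (insert (0::'k) {\<kappa>. \<exists>u w. w \<noteq> 0 \<and>
        bounded_int ((fact CARD('n) * s ^ CARD('n)) ^ 2) u \<and> bounded_int ((fact CARD('n) * s ^ CARD('n)) ^ 2) w \<and>
        to_ac \<kappa> * w = u}) ^ CARD('n)"
      by (rule card_projectively_rational_le[OF assms(1) A(1) rs(2) _ _ _ _ inj])
        (use good in \<open>auto simp: good_def\<close>)
    then show "finite {P :: ('k, 'n) proj_space. preperiodic \<psi> (proj_to_ac P)} \<and>
        card {P :: ('k, 'n) proj_space. preperiodic \<psi> (proj_to_ac P)} \<le>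
        2 ^ CARD('n) * card (insert (0::'k) {\<kappa>. \<exists>u w. w \<noteq> 0 \<and>
        bounded_int ((fact CARD('n) * s ^ CARD('n)) ^ 2) u \<and> bounded_int ((fact CARD('n) * s ^ CARD('n)) ^ 2) w \<and>
        to_ac \<kappa> * w = u}) ^ CARD('n)"
      unfolding S_def .
  qed
qed

end
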